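(* Let $p$ be a Nehari function and let $\phi:\mathbb{D}\to\mathbb{C}^n$ ($n\ge 1$) be holomorphic with $\phi'\neq 0$ on $\mathbb{D}$ and $$|\mathcal{S}\phi(z)|+\frac34\,|\phi'(z)|^2\,|K(\phi(z))|\le 2p(|z|),\qquad z\in\mathbb{D}.\qquad ( * )$$ Suppose that the closed curve $\Gamma=\phi(\partial\mathbb{D})\subset\mathbb{C}^n\cup\{\infty\}$ is not simple and let $P$ be a cut point of $\Gamma$. Then there exists a Euclidean circle or line $C$ such that $C\setminus\{P\}\subset\Sigma=\phi(\mathbb{D})$. Furthermore, equality holds in $( * )$ at every point $z\in\phi^{-1}(C\setminus\{P\})$.
   Context: $\mathbb{D}$ is the open unit disk in $\mathbb{C}$. For a holomorphic curve $\phi=(f_1,\dots,f_n):\mathbb{D}\to\mathbb{C}^n$ with $\phi'=(f_1',\dots,f_n')\ne 0$, put $\sigma=\frac12\log(|f_1'|^2+\cdots+|f_n'|^2)$, so $|\phi'|=e^{\sigma}$ is the Euclidean norm of $\phi'$. The Schwarzian derivative of $\phi$ is $\mathcal{S}\phi=2(\sigma_{zz}-\sigma_z^2)$, where $\sigma_z=\frac12(\sigma_x-i\sigma_y)$. $K(\phi(z))=-e^{-2\sigma(z)}\Delta\sigma(z)\le 0$ denotes the Gaussian curvature at $\phi(z)$ of the surface $\Sigma=\phi(\mathbb{D})\subset\mathbb{C}^n=\mathbb{R}^{2n}$ (with metric induced from the Euclidean metric). A Nehari function is a positive, even, continuous function $p:(-1,1)\to\mathbb{R}$ such that (a) $(1-x^2)^2p(x)$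 is non-increasing for $x\in[0,1)$, and (b) the differential equation $u''+pu=0$ has no nontrivial solution with more than one zero in $(-1,1)$. Under the hypotheses on $\phi$, the map $\phi$ has an extension to $\overline{\mathbb{D}}$, with values in $\mathbb{C}^n\cup\{\infty\}$, which is continuous with respect to the spherical metric (the metric on $\mathbb{C}^n\cup\{\infty\}=\mathbb{R}^{2n}\cup\{\infty\}\cong S^{2n}$ given by stereographic projection); the extension is also denoted $\phi$. The closed curve $\Gamma=\phi(\partial\mathbb{D})$ is not simple if there are distinct points $\zeta_1,\zeta_2\in\partial\mathbb{D}$ with $\phi(\zeta_1)=\phi(\zeta_2)=P$; such a point $P\in\mathbb{C}^n\cup\{\infty\}$ is called a cut point of $\Gamma$. Circles and lines are real Euclidean circles and lines in $\mathbb{R}^{2n}=\mathbb{C}^n$. *)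

theory Defs
  imports "HOL-Analysis.Analysis"
begin

definition nehari_function :: "(real \<Rightarrow> real) \<Rightarrow> bool" where
  "nehari_function p \<longleftrightarrow>
     continuous_on {-1<..<1} p \<and>
     (\<forall>x\<in>{-1<..<1}. 0 < p x) \<and>
     (\<forall>x\<in>{-1<..<1}. p (-x) = p x) \<and>
     antimono_on {0..<1} (\<lambda>x. (1 - x\<^sup>2)\<^sup>2 * p x) \<and>
     (\<forall>u u'. (\<forall>x\<in>{-1<..<1}. (u has_real_derivative u' x) (at x)
                    \<and> (u' has_real_derivative - (p x * u x)) (at x))
           \<and> (\<exists>x\<in>{-1<..<1}. u x \<noteq> 0)
       \<longrightarrow> \<not> (\<exists>x\<in>{-1<..<1}. \<exists>y\<in>{-1<..<1}. x \<noteq> y \<and> u x = 0 \<and> u y = 0))"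

definition curve_holomorphic_on :: "(complex \<Rightarrow> complex ^ 'n) \<Rightarrow> complex set \<Rightarrow> bool" where
  "curve_holomorphic_on \<phi> S \<longleftrightarrow> (\<forall>k. (\<lambda>z. \<phi> z $ k) holomorphic_on S)"

definition curve_deriv :: "(complex \<Rightarrow> complex ^ 'n) \<Rightarrow> complex \<Rightarrow> complex ^ 'n" where
  "curve_deriv \<phi> z = (\<chi> k. deriv (\<lambda>w. \<phi> w $ k) z)"

definition partial_x :: "(complex \<Rightarrow> 'a::real_normed_vector) \<Rightarrow> complex \<Rightarrow> 'a" where
  "partial_x f z = vector_derivative (\<lambda>t. f (z + of_real t)) (at 0)"

definition partial_y :: "(complex \<Rightarrow> 'a::real_normed_vector) \<Rightarrow> complex \<Rightarrow> 'a" where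
  "partial_y f z = vector_derivative (\<lambda>t. f (z + \<i> * of_real t)) (at 0)"

definition wirtinger :: "(complex \<Rightarrow> complex) \<Rightarrow> complex \<Rightarrow> complex" where
  "wirtinger f z = (partial_x f z - \<i> * partial_y f z) / 2"

definition laplacian :: "(complex \<Rightarrow> real) \<Rightarrow> complex \<Rightarrow> real" where
  "laplacian f z = partial_x (partial_x f) z + partial_y (partial_y f) z"

definition log_speed :: "(complex \<Rightarrow> complex ^ 'n) \<Rightarrow> complex \<Rightarrow> real" where
  "log_speed \<phi> z = ln (\<Sum>k\<in>UNIV. (cmod (deriv (\<lambda>w. \<phi> w $ k) z))\<^sup>2) / 2"

definition schwarzian :: "(complex \<Rightarrow> complex ^ 'n) \<Rightarrow> complex \<Rightarrow> complex" where
  "schwarzian \<phi> z =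
     (let \<sigma> = (\<lambda>w. complex_of_real (log_speed \<phi> w))
      in 2 * (wirtinger (wirtinger \<sigma>) z - (wirtinger \<sigma> z)\<^sup>2))"

text \<open>Gaussian curvature, at the point \<open>\<phi> z\<close>, of the surface parametrized by \<open>\<phi>\<close>,
  as a function of the conformal parameter \<open>z\<close>.\<close>

definition curvature :: "(complex \<Rightarrow> complex ^ 'n) \<Rightarrow> complex \<Rightarrow> real" where
  "curvature \<phi> z = - exp (- 2 * log_speed \<phi> z) * laplacian (log_speed \<phi>) z"

definition criterion_lhs :: "(complex \<Rightarrow> complex ^ 'n) \<Rightarrow> complex \<Rightarrow> real" where
  "criterion_lhs \<phi> z =
     cmod (schwarzian \<phi> z) + 3 / 4 * (norm (curve_deriv \<phi> z))\<^sup>2 * \<bar>curvature \<phi> z\<bar>"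

text \<open>The extended space \<open>\<complex>\<^sup>n \<union> {\<infinity>}\<close> is the option type, with \<open>None\<close> as the point at infinity.
  Its spherical metric is the pullback under \<open>stereo\<close> of the Euclidean metric on the unit sphere
  of \<open>\<complex>\<^sup>n \<times> \<real>\<close>, so a map into it is continuous iff its composition with \<open>stereo\<close> is.\<close>

definition stereo :: "(complex ^ 'n) option \<Rightarrow> (complex ^ 'n) \<times> real" where
  "stereo P = (case P of
      None \<Rightarrow> (0, 1)
    | Some w \<Rightarrow> ((2 / ((norm w)\<^sup>2 + 1)) *\<^sub>R w, ((norm w)\<^sup>2 - 1) / ((norm w)\<^sup>2 + 1)))"

text \<open>There is at most one such extension on the closed disk, since the open disk is dense in it.\<close>

definition spherical_extension ::
  "(complex \<Rightarrow> complex ^ 'n) \<Rightarrow> (complex \<Rightarrow> (complex ^ 'n) option) \<Rightarrow> bool" where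
  "spherical_extension \<phi> \<Phi> \<longleftrightarrow>
     (\<forall>z\<in>ball 0 1. \<Phi> z = Some (\<phi> z)) \<and> continuous_on (cball 0 1) (stereo \<circ> \<Phi>)"

definition cut_point :: "(complex \<Rightarrow> (complex ^ 'n) option) \<Rightarrow> (complex ^ 'n) option \<Rightarrow> bool" where
  "cut_point \<Phi> P \<longleftrightarrow>
     (\<exists>\<zeta>\<^sub>1\<in>sphere 0 1. \<exists>\<zeta>\<^sub>2\<in>sphere 0 1. \<zeta>\<^sub>1 \<noteq> \<zeta>\<^sub>2 \<and> \<Phi> \<zeta>\<^sub>1 = P \<and> \<Phi> \<zeta>\<^sub>2 = P)"

text \<open>Dimensions are real: \<open>affine\<close> and \<open>aff_dim\<close> refer to the real vector space underlying
  \<open>\<complex>\<^sup>n\<close>.\<close>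

definition euclidean_circle :: "'a::euclidean_space set \<Rightarrow> bool" where
  "euclidean_circle C \<longleftrightarrow>
     (\<exists>A c r. affine A \<and> aff_dim A = 2 \<and> c \<in> A \<and> 0 < r \<and> C = A \<inter> sphere c r)"

definition euclidean_line :: "'a::euclidean_space set \<Rightarrow> bool" where
  "euclidean_line C \<longleftrightarrow> affine C \<and> aff_dim C = 1"

end

theory Submission
  imports Defs "HOL-Complex_Analysis.Cauchy_Integral_Formula"
begin

text \<open>
  The criterion is used through the restrictions of \<open>\<phi>\<close> to the hyperbolic geodesics of the disk, and the
  theorem is the extremal case of a comparison theorem for curves in Euclidean space.

  Let \<open>T\<close> parametrize a geodesic over \<open>(-1, 1)\<close>, with \<open>T 0\<close> the point nearest to the origin. The Ahlfors
  Schwarzian of the real curve \<open>f = \<phi> \<circ> T\<close> is at most \<open>\<bar>T'\<bar>\<^sup>2\<close> times the left-hand side of the criterion at \<open>T x\<close>: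
  \<open>T\<close> is a Moebius map, and the term \<open>3/4 \<bar>\<phi>'\<bar>\<^sup>2 \<bar>K\<bar>\<close> is exactly what the bending of the surface contributes
  (\<open>ahlfors_schwarzian_moebius_parameter\<close>, \<open>criterion_lhs_eq\<close>). Since \<open>(1 - x\<^sup>2)\<^sup>2 p x\<close> is non-increasing on \<open>[0, 1)\<close> and
  \<open>\<bar>T x\<bar> \<ge> \<bar>x\<bar>\<close>, this is at most \<open>2 p x\<close> (\<open>geodesic_image_curve\<close>).

  Let \<open>F\<close> be the image of \<open>f\<close> under the identity, or under the inversion centered at a finite point, and put
  \<open>w = \<bar>F'\<bar> powr (-1/2)\<close>. Then \<open>w'' + p w \<ge> 0\<close>, where the excess is a sum of two nonnegative terms, one for the
  gap in the Schwarzian bound and one for the curvature of \<open>F\<close> (\<open>curve_riccati_data\<close>, \<open>inverted_curve_riccati_data\<close>).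
  The Nehari property provides a positive solution \<open>u\<close> of \<open>u'' + p u = 0\<close>, so \<open>h = w / u\<close> is a convex function of
  \<open>s = \<integral> u\<^sup>-\<^sup>2\<close>, while \<open>F\<close> has speed \<open>h\<^sup>-\<^sup>2\<close> with respect to \<open>s\<close>. A positive convex function that is not constant grows
  linearly in at least one direction, and in that direction \<open>F\<close> has finite length. Hence, if \<open>F\<close> tends to infinity at
  both ends, \<open>h\<close> is constant and both terms of the excess vanish (\<open>riccati_rigidity\<close>): \<open>F\<close> moves with constant
  velocity in \<open>s\<close> and describes a full line (\<open>velocity_proportional_line\<close>).

  This has two applications. If \<open>\<phi>\<close> took the same value at an interior point and at another point of the closed disk,
  inversion at that value would produce such an \<open>F\<close> on an arc where \<open>h\<close> tends to \<open>0\<close> at an interior end, so it would not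
  be a positive constant (\<open>no_arc_between_zeros\<close>, \<open>extension_injective_from_interior\<close>). And if two boundary points share the value \<open>P\<close>,
  the geodesic joining them is mapped by \<open>F\<close> onto a full line, so that \<open>f\<close> describes a line, if \<open>P\<close> is infinite, or a
  circle with the point \<open>P\<close> removed. Along this geodesic the criterion holds with equality, and by injectivity it contains
  all preimages of points of the curve.
\<close>

section \<open>The disconjugate linear equation\<close>

text \<open>One integration gains a factor \<open>\<bar>x\<bar> / (n + 1)\<close>; iterated, this produces the factorials that make
  the series in the next existence proof converge.\<close>

lemma primitive_power_bound:
  fixes G g :: "real \<Rightarrow> real"
  assumes deriv: "\<And>t. \<bar>t\<bar> \<le> r \<Longrightarrow> (G has_real_derivative g t) (at t)"
    and bound: "\<And>t. \<bar>t\<bar> \<le> r \<Longrightarrow> \<bar>g t\<bar> \<le> C * \<bar>t\<bar> ^ n"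
    and zero: "G 0 = 0" and x: "\<bar>x\<bar> \<le> r"
  shows "\<bar>G x\<bar> \<le> C * \<bar>x\<bar> ^ Suc n / Suc n"
proof -
  have pos: "H y \<le> C * y ^ Suc n / Suc n"
    if H: "\<And>t. \<bar>t\<bar> \<le> r \<Longrightarrow> (H has_real_derivative g' t) (at t)"
      and g': "\<And>t. \<bar>t\<bar> \<le> r \<Longrightarrow> \<bar>g' t\<bar> \<le> C * \<bar>t\<bar> ^ n"
      and H0: "H 0 = 0" and y: "0 \<le> y" "y \<le> r" for H g' y
  proof -
    have "C * 0 ^ Suc n / Suc n - H 0 \<le> C * y ^ Suc n / Suc n - H y"
    proof (rule DERIV_nonneg_imp_nondecreasing[OF y(1)])
      fix t assume t: "0 \<le> t" "t \<le> y"
      have "((\<lambda>t. C * t ^ Suc n / Suc n - H t) has_real_derivative C * t ^ n - g' t) (at t)"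
      proof -
        have "((\<lambda>t. C / Suc n * t ^ Suc n - H t) has_real_derivative C / Suc n * (Suc n * t ^ n) - g' t) (at t)"
        proof (intro DERIV_diff DERIV_cmult)
          show "((\<lambda>t. t ^ Suc n) has_real_derivative Suc n * t ^ n) (at t)"
            using DERIV_pow[of "Suc n" t] by simp
          show "(H has_real_derivative g' t) (at t)"
            by (rule H) (use t y in linarith)
        qed
        then show ?thesis by simp
      qed
      moreover have "0 \<le> C * t ^ n - g' t"
        using g'[of t] t y by auto
      ultimately show "\<exists>d. ((\<lambda>t. C * t ^ Suc n / Suc n - H t) has_real_derivative d) (at t) \<and> 0 \<le> d"
        by blast
    qed
    then show ?thesis using H0 by simp
  qed
  have minus: "((\<lambda>t. H (- t)) has_real_derivative - g' (- t)) (at t)"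
    if "(H has_real_derivative g' (- t)) (at (- t))" for H g' :: "real \<Rightarrow> real" and t
    using DERIV_mirror[of H "g' (- t)" t] that by simp
  have ub: "H y \<le> C * \<bar>y\<bar> ^ Suc n / Suc n"
    if H: "\<And>t. \<bar>t\<bar> \<le> r \<Longrightarrow> (H has_real_derivative g' t) (at t)"
      and g': "\<And>t. \<bar>t\<bar> \<le> r \<Longrightarrow> \<bar>g' t\<bar> \<le> C * \<bar>t\<bar> ^ n"
      and H0: "H 0 = 0" and y: "\<bar>y\<bar> \<le> r" for H g' y
  proof (cases "0 \<le> y")
    case True
    then show ?thesis using pos[OF H g' H0, of y] y by simp
  next
    case False
    have "(\<lambda>t. H (- t)) (- y) \<le> C * (- y) ^ Suc n / Suc n"
    proof (rule pos[where g' = "\<lambda>t. - g' (- t)"])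
      fix t :: real assume t: "\<bar>t\<bar> \<le> r"
      show "((\<lambda>t. H (- t)) has_real_derivative - g' (- t)) (at t)"
        by (rule minus, rule H) (use t in simp)
      show "\<bar>- g' (- t)\<bar> \<le> C * \<bar>t\<bar> ^ n" using g'[of "- t"] t by simp
    qed (use False y H0 in auto)
    then show ?thesis using False by simp
  qed
  have "G x \<le> C * \<bar>x\<bar> ^ Suc n / Suc n"
    by (rule ub[OF deriv bound zero x])
  moreover have "(\<lambda>t. - G t) x \<le> C * \<bar>x\<bar> ^ Suc n / Suc n"
    by (rule ub[where g' = "\<lambda>t. - g t"]) (use bound zero x in \<open>auto intro!: derivative_intros deriv\<close>)
  ultimately show ?thesis by linarith
qed

lemma primitive_exists:
  fixes g :: "real \<Rightarrow> real"
  assumes "continuous_on {-1<..<1} g"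
  shows "\<exists>G. G 0 = 0 \<and> (\<forall>x\<in>{-1<..<1}. (G has_real_derivative g x) (at x))"
proof -
  have "isCont g x" if "ereal (-1) < ereal x" "ereal x < ereal 1" for x
    using assms that by (simp add: continuous_on_eq_continuous_at)
  from einterval_antiderivative[of "ereal (-1)" "ereal 1", OF _ this]
  obtain G where "\<And>x. -1 < x \<Longrightarrow> x < 1 \<Longrightarrow> (G has_vector_derivative g x) (at x)"
    by (auto simp del: uminus_ereal.simps)
  then have "\<forall>x\<in>{-1<..<1}. ((\<lambda>x. G x - G 0) has_real_derivative g x) (at x)"
    by (auto simp: has_real_derivative_iff_has_vector_derivative intro!: derivative_eq_intros)
  then show ?thesis by (intro exI[of _ "\<lambda>x. G x - G 0"]) simp
qed

text \<open>Picard iteration: the solution is the series whose terms \<open>a\<close> are obtained from each other by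
  multiplying by \<open>- p\<close> and integrating twice from \<open>0\<close>. On a compact subinterval on which \<open>\<bar>p\<bar> \<le> M\<close>
  the \<open>n\<close>-th term is at most \<open>M ^ n / fact n\<close>, so the series may be differentiated termwise.\<close>

lemma linear_ode_solution:
  fixes p :: "real \<Rightarrow> real"
  assumes p: "continuous_on {-1<..<1} p"
  obtains u v where "u 0 = 1"
    "\<And>x. x \<in> {-1<..<1} \<Longrightarrow> (u has_real_derivative v x) (at x)"
    "\<And>x. x \<in> {-1<..<1} \<Longrightarrow> (v has_real_derivative - (p x * u x)) (at x)"
proof -
  let ?I = "{-1<..<1::real}"
  define prim where "prim g = (SOME G. G 0 = 0 \<and> (\<forall>x\<in>?I. (G has_real_derivative g x) (at x)))" for g
  define a where "a = rec_nat (\<lambda>_. 1) (\<lambda>_ g. prim (prim (\<lambda>x. - (p x * g x))))"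
  define b where "b n = prim (\<lambda>x. - (p x * a n x))" for n
  have a0: "a 0 = (\<lambda>_. 1)" and aS: "a (Suc n) = prim (b n)" for n
    by (simp_all add: a_def b_def)
  have prim: "prim g 0 = 0 \<and> (\<forall>x\<in>?I. (prim g has_real_derivative g x) (at x))"
    if "continuous_on ?I g" for g
    unfolding prim_def using someI_ex[OF primitive_exists[OF that]] .
  have cont_prim: "continuous_on ?I (prim g)" if "continuous_on ?I g" for g
    using prim[OF that] by (meson DERIV_isCont continuous_at_imp_continuous_on)
  have cont: "continuous_on ?I (a n)" for n
  proof (induction n)
    case (Suc n)
    then show ?case unfolding aS b_def by (intro cont_prim continuous_intros p)
  qed (simp add: a0)
  have cont_b: "continuous_on ?I (b n)" for n
    unfolding b_def by (intro cont_prim continuous_intros p cont)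
  have b: "b n 0 = 0" "x \<in> ?I \<Longrightarrow> (b n has_real_derivative - (p x * a n x)) (at x)" for n x
    using prim[of "\<lambda>x. - (p x * a n x)"] continuous_on_minus[OF continuous_on_mult[OF p cont[of n]]]
    by (auto simp: b_def)
  have a: "a (Suc n) 0 = 0" "x \<in> ?I \<Longrightarrow> (a (Suc n) has_real_derivative b n x) (at x)" for n x
    using prim[OF cont_b[of n]] by (auto simp: aS)
  have local: "((\<lambda>x. \<Sum>n. a n x) has_real_derivative (\<Sum>n. b n x)) (at x)
      \<and> ((\<lambda>x. \<Sum>n. b n x) has_real_derivative - (p x * (\<Sum>n. a n x))) (at x)" if x: "x \<in> ?I" for x
  proof -
    \<comment> \<open>Uniform bounds on \<open>p\<close> exist only on compact subintervals, so work on one that contains \<open>x\<close>.\<close>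
    define r where "r = (1 + \<bar>x\<bar>) / 2"
    have r: "\<bar>x\<bar> < r" "0 < r" "r < 1" using x by (auto simp: r_def)
    have "compact (p ` {-r..r})"
      by (intro compact_continuous_image continuous_on_subset[OF p]) (use r in auto)
    then obtain M where M: "0 < M" "\<And>t. \<bar>t\<bar> \<le> r \<Longrightarrow> \<bar>p t\<bar> \<le> M"
      using compact_imp_bounded[of "p ` {-r..r}"] by (auto simp: bounded_pos abs_le_iff)
    have bounds: "\<forall>t. \<bar>t\<bar> \<le> r \<longrightarrow> \<bar>a n t\<bar> \<le> M ^ n / fact n * \<bar>t\<bar> ^ n"
      "\<forall>t. \<bar>t\<bar> \<le> r \<longrightarrow> \<bar>b n t\<bar> \<le> M ^ Suc n / fact n * \<bar>t\<bar> ^ n" for n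
    proof -
      have step: "\<forall>t. \<bar>t\<bar> \<le> r \<longrightarrow> \<bar>b n t\<bar> \<le> M ^ Suc n / fact n * \<bar>t\<bar> ^ n"
        if an: "\<forall>t. \<bar>t\<bar> \<le> r \<longrightarrow> \<bar>a n t\<bar> \<le> M ^ n / fact n * \<bar>t\<bar> ^ n" for n
      proof (intro allI impI)
        fix t :: real assume t: "\<bar>t\<bar> \<le> r"
        have "\<bar>b n t\<bar> \<le> M ^ Suc n / fact n * \<bar>t\<bar> ^ Suc n / Suc n"
        proof (rule primitive_power_bound[of r _ _ _ n t])
          fix s :: real assume s: "\<bar>s\<bar> \<le> r"
          show "(b n has_real_derivative - (p s * a n s)) (at s)"
            by (rule b(2)) (use s r in auto)
          have "\<bar>p s\<bar> * \<bar>a n s\<bar> \<le> M * (M ^ n / fact n * \<bar>s\<bar> ^ n)"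
            using M s an by (intro mult_mono) auto
          then show "\<bar>- (p s * a n s)\<bar> \<le> M ^ Suc n / fact n * \<bar>s\<bar> ^ n"
            by (simp add: abs_mult)
        qed (use b t in auto)
        also have "\<dots> \<le> M ^ Suc n / fact n * \<bar>t\<bar> ^ Suc n / 1"
          by (rule divide_left_mono) (use M(1) in auto)
        also have "\<dots> = M ^ Suc n / fact n * \<bar>t\<bar> ^ Suc n" by (rule div_by_1)
        also have "\<dots> \<le> M ^ Suc n / fact n * \<bar>t\<bar> ^ n"
          using M t r by (intro mult_left_mono power_decreasing) auto
        finally show "\<bar>b n t\<bar> \<le> M ^ Suc n / fact n * \<bar>t\<bar> ^ n" .
      qed
      show A: "\<forall>t. \<bar>t\<bar> \<le> r \<longrightarrow> \<bar>a n t\<bar> \<le> M ^ n / fact n * \<bar>t\<bar> ^ n"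
      proof (induction n)
        case (Suc n)
        show ?case
        proof (intro allI impI)
          fix t :: real assume t: "\<bar>t\<bar> \<le> r"
          have "\<bar>a (Suc n) t\<bar> \<le> M ^ Suc n / fact n * \<bar>t\<bar> ^ Suc n / Suc n"
          proof (rule primitive_power_bound[of r _ "b n" _ n t])
            show "(a (Suc n) has_real_derivative b n s) (at s)" if "\<bar>s\<bar> \<le> r" for s
              by (rule a(2)) (use that r in auto)
            show "\<bar>b n s\<bar> \<le> M ^ Suc n / fact n * \<bar>s\<bar> ^ n" if "\<bar>s\<bar> \<le> r" for s
              using step[OF Suc] that by blast
          qed (rule a(1), rule t)
          also have "M ^ Suc n / fact n * \<bar>t\<bar> ^ Suc n / Suc n = M ^ Suc n / fact (Suc n) * \<bar>t\<bar> ^ Suc n"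
            by (simp only: fact_Suc of_nat_mult times_divide_eq_left times_divide_eq_right divide_divide_eq_left mult_ac)
          finally show "\<bar>a (Suc n) t\<bar> \<le> M ^ Suc n / fact (Suc n) * \<bar>t\<bar> ^ Suc n" .
        qed
      qed (simp add: a0)
      show "\<forall>t. \<bar>t\<bar> \<le> r \<longrightarrow> \<bar>b n t\<bar> \<le> M ^ Suc n / fact n * \<bar>t\<bar> ^ n"
        by (rule step[OF A])
    qed
    let ?S = "{-r<..<r}"
    have pow: "\<bar>t\<bar> ^ n \<le> 1" if "t \<in> ?S" for t n
      using that r by (intro power_le_one) auto
    have exp_sum: "summable (\<lambda>n. M ^ n / fact n)"
      using summable_exp[of M] by (simp add: divide_inverse mult.commute)
    have a_le: "norm (a n t) \<le> M ^ n / fact n" and b_le: "norm (b n t) \<le> M * (M ^ n / fact n)"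
      if t: "t \<in> ?S" for t n
    proof -
      have tr: "\<bar>t\<bar> \<le> r" using t by auto
      have "\<bar>a n t\<bar> \<le> M ^ n / fact n * \<bar>t\<bar> ^ n" by (rule bounds(1)[rule_format, OF tr])
      also have "\<dots> \<le> M ^ n / fact n * 1" using M(1) pow[OF t] by (intro mult_left_mono) simp_all
      finally show "norm (a n t) \<le> M ^ n / fact n" by simp
      have "\<bar>b n t\<bar> \<le> M ^ Suc n / fact n * \<bar>t\<bar> ^ n" by (rule bounds(2)[rule_format, OF tr])
      also have "\<dots> \<le> M ^ Suc n / fact n * 1" using M(1) pow[OF t] by (intro mult_left_mono) simp_all
      finally show "norm (b n t) \<le> M * (M ^ n / fact n)" by simp
    qed
    have xS: "x \<in> interior ?S" "x \<in> ?S" using r by auto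
    have sa: "summable (\<lambda>n. a n t)" if "t \<in> ?S" for t
      by (rule summable_comparison_test'[OF exp_sum a_le[OF that]])
    have sb: "summable (\<lambda>n. b n t)" if "t \<in> ?S" for t
      by (rule summable_comparison_test'[OF summable_mult[OF exp_sum] b_le[OF that]])
    have SI: "?S \<subseteq> ?I" using r by auto
    have "((\<lambda>t. \<Sum>n. b n t) has_real_derivative (\<Sum>n. - (p x * a n x))) (at x)"
    proof (rule has_field_derivative_series'(2)[of ?S b "\<lambda>n t. - (p t * a n t)" 0 x])
      show "(b n has_real_derivative - (p t * a n t)) (at t within ?S)" if "t \<in> ?S" for n t
        by (rule has_field_derivative_at_within, rule b(2)) (use that SI in blast)
      show "uniformly_convergent_on ?S (\<lambda>n t. \<Sum>i<n. - (p t * a i t))"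
      proof (rule Weierstrass_m_test')
        show "norm (- (p t * a n t)) \<le> M * (M ^ n / fact n)" if "t \<in> ?S" for n t
        proof -
          have "\<bar>t\<bar> \<le> r" using that by auto
          then have "\<bar>p t\<bar> * norm (a n t) \<le> M * (M ^ n / fact n)"
            using M a_le[OF that] by (intro mult_mono) simp_all
          then show ?thesis by (simp add: abs_mult)
        qed
      qed (rule summable_mult[OF exp_sum])
    qed (rule convex_real_interval, use r in simp, rule sb, use r in simp, rule xS)
    moreover have "(\<Sum>n. - (p x * a n x)) = - (p x * (\<Sum>n. a n x))"
      using sa[OF xS(2)] by (simp add: suminf_minus summable_mult suminf_mult)
    ultimately have v: "((\<lambda>t. \<Sum>n. b n t) has_real_derivative - (p x * (\<Sum>n. a n x))) (at x)"
      by simp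
    have "((\<lambda>t. \<Sum>n. a (Suc n) t) has_real_derivative (\<Sum>n. b n x)) (at x)"
    proof (rule has_field_derivative_series'(2)[of ?S "\<lambda>n. a (Suc n)" b 0 x])
      show "(a (Suc n) has_real_derivative b n t) (at t within ?S)" if "t \<in> ?S" for n t
        by (rule has_field_derivative_at_within, rule a(2)) (use that SI in blast)
      show "uniformly_convergent_on ?S (\<lambda>n t. \<Sum>i<n. b i t)"
        by (rule Weierstrass_m_test'[OF b_le summable_mult[OF exp_sum]])
      show "summable (\<lambda>n. a (Suc n) 0)" using sa[of 0] r summable_Suc_iff[of "\<lambda>n. a n 0"] by simp
    qed (rule convex_real_interval, use r in simp, rule xS)
    then have "((\<lambda>t. 1 + (\<Sum>n. a (Suc n) t)) has_real_derivative (\<Sum>n. b n x)) (at x)"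
      by (auto intro!: derivative_eq_intros)
    then have "((\<lambda>t. \<Sum>n. a n t) has_real_derivative (\<Sum>n. b n x)) (at x)"
    proof (rule has_field_derivative_transform_within_open[where S = ?S])
      show "1 + (\<Sum>n. a (Suc n) t) = (\<Sum>n. a n t)" if "t \<in> ?S" for t
        using suminf_split_head[OF sa[OF that]] by (simp add: a0)
    qed (use xS in auto)
    with v show ?thesis by blast
  qed
  have "(\<Sum>n. a n 0) = (\<Sum>n\<in>{0}. a n 0)"
    by (rule suminf_finite) (auto simp: a(1) gr0_conv_Suc)
  then have "(\<Sum>n. a n 0) = 1" by (simp add: a0)
  with local show ?thesis by (intro that[of "\<lambda>x. \<Sum>n. a n x" "\<lambda>x. \<Sum>n. b n x"]) blast+
qed

definition positive_solution :: "(real \<Rightarrow> real) \<Rightarrow> (real \<Rightarrow> real) \<Rightarrow> (real \<Rightarrow> real) \<Rightarrow> bool" where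
  "positive_solution p u u' \<longleftrightarrow>
     (\<forall>x\<in>{-1<..<1}. 0 < u x \<and> (u has_real_derivative u' x) (at x) \<and>
        (u' has_real_derivative - (p x * u x)) (at x))"

text \<open>An even solution with a zero \<open>x\<close> would also vanish at \<open>- x\<close>, which the defining property of a
  Nehari function forbids; normalized to be positive at \<open>0\<close>, it is positive throughout.\<close>

lemma nehari_positive_solution:
  assumes "nehari_function p"
  obtains u u' where "positive_solution p u u'"
proof -
  let ?I = "{-1<..<1::real}"
  have p: "continuous_on ?I p" "\<And>x. x \<in> ?I \<Longrightarrow> p (- x) = p x"
    using assms by (auto simp: nehari_function_def)
  have disconjugate: "x = y"
    if "\<forall>x\<in>?I. (u has_real_derivative u' x) (at x) \<and> (u' has_real_derivative - (p x * u x)) (at x)"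
      "\<exists>x\<in>?I. u x \<noteq> 0" "x \<in> ?I" "y \<in> ?I" "u x = 0" "u y = 0" for u u' x y
    using assms that unfolding nehari_function_def by blast
  obtain u v where u: "u 0 = 1"
    "\<And>x. x \<in> ?I \<Longrightarrow> (u has_real_derivative v x) (at x)"
    "\<And>x. x \<in> ?I \<Longrightarrow> (v has_real_derivative - (p x * u x)) (at x)"
    using linear_ode_solution[OF p(1)] by blast
  \<comment> \<open>The even part solves the equation because \<open>p\<close> is even, and its zeros come in pairs \<open>\<plusminus> x\<close>.\<close>
  define e where "e x = u x + u (- x)" for x
  define e' where "e' x = v x - v (- x)" for x
  have mirror: "((\<lambda>t. g (- t)) has_real_derivative - d) (at x)"
    if "(g has_real_derivative d) (at (- x))" for g d and x :: real
    using DERIV_mirror[of g d x] that by simp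
  have e: "(e has_real_derivative e' x) (at x)" "(e' has_real_derivative - (p x * e x)) (at x)" if "x \<in> ?I" for x
  proof -
    have m: "- x \<in> ?I" using that by auto
    have "(e has_real_derivative v x + - v (- x)) (at x)"
      unfolding e_def by (intro DERIV_add u(2) mirror that m)
    then show "(e has_real_derivative e' x) (at x)" by (simp add: e'_def)
    have "(e' has_real_derivative - (p x * u x) - - (- (p (- x) * u (- x)))) (at x)"
      unfolding e'_def by (intro DERIV_diff u(3) mirror that m)
    then show "(e' has_real_derivative - (p x * e x)) (at x)"
      by (simp add: e_def p(2)[OF that] algebra_simps)
  qed
  have e0: "e 0 = 2" by (simp add: e_def u(1))
  have nonzero: "e x \<noteq> 0" if x: "x \<in> ?I" for x
  proof
    assume "e x = 0"
    moreover have "e (- x) = e x" by (simp add: e_def)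
    ultimately have "x = - x"
      using disconjugate[of e e' x "- x"] e e0 x by force
    then show False using \<open>e x = 0\<close> e0 by simp
  qed
  have "0 < e x" if x: "x \<in> ?I" for x
  proof (rule ccontr)
    assume neg: "\<not> 0 < e x"
    have "connected (e ` ?I)"
      by (intro connected_continuous_image continuous_at_imp_continuous_on ballI DERIV_isCont[OF e(1)]) auto
    moreover have "e x \<in> e ` ?I" "e 0 \<in> e ` ?I" using x by auto
    ultimately have "0 \<in> e ` ?I"
      using neg e0 connected_iff_interval[of "e ` ?I"] by (metis linorder_not_le order_less_imp_le zero_less_numeral)
    then show False using nonzero by auto
  qed
  with e have "positive_solution p e e'" by (simp add: positive_solution_def)
  then show ?thesis by (rule that)
qed

section \<open>Comparison with a positive solution\<close>

text \<open>The function \<open>h\<close> is convex with respect to the parameter \<open>s = \<integral> u\<^sup>-\<^sup>2\<close>: its derivative with respect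
  to \<open>s\<close> is \<open>k\<close>, and \<open>k\<close> is nondecreasing. The curve \<open>F\<close> has speed \<open>h\<^sup>-\<^sup>2\<close> with respect to \<open>s\<close>.
  Stating this in the original parameter avoids the change of variables.\<close>

definition sturm_data ::
  "real \<Rightarrow> real \<Rightarrow> (real \<Rightarrow> real) \<Rightarrow> (real \<Rightarrow> real) \<Rightarrow> (real \<Rightarrow> real) \<Rightarrow> (real \<Rightarrow> 'a::real_normed_vector) \<Rightarrow> bool"
  where
  "sturm_data a b u h k F \<longleftrightarrow>
     mono_on {a<..<b} k \<and>
     (\<forall>x\<in>{a<..<b}. 0 < u x \<and> 0 < h x \<and> (h has_real_derivative k x / (u x)\<^sup>2) (at x) \<and>
        (\<exists>F'. (F has_vector_derivative F') (at x) \<and> norm F' = 1 / (h x * u x)\<^sup>2))"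

text \<open>A convex function that increases somewhere grows at least linearly in \<open>s\<close> from there on, and the
  integral of \<open>h\<^sup>-\<^sup>2\<close> along the remaining interval is then finite, whatever its end: it is bounded by
  the total variation of \<open>1 / (h * k c)\<close>.\<close>

lemma sturm_data_bounded:
  assumes S: "sturm_data a b u h k F" and c: "c \<in> {a<..<b}" "0 < k c" and x: "c \<le> x" "x < b"
  shows "norm (F x - F c) \<le> 1 / (h c * k c)"
proof (cases "x = c")
  case True
  moreover have "0 < h c * k c" using S c by (auto simp: sturm_data_def)
  ultimately show ?thesis by simp
next
  case False
  then have cx: "c < x" using x by simp
  have S: "0 < u t" "0 < h t" "(h has_real_derivative k t / (u t)\<^sup>2) (at t)"
    "\<exists>F'. (F has_vector_derivative F') (at t) \<and> norm F' = 1 / (h t * u t)\<^sup>2" "k c \<le> k t"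
    if "c \<le> t" "t \<le> x" for t
    using S that c x unfolding sturm_data_def by (auto intro: mono_onD)
  define F' where "F' t = vector_derivative F (at t)" for t
  have F': "(F has_vector_derivative F' t) (at t)" "norm (F' t) = 1 / (h t * u t)\<^sup>2"
    if "c \<le> t" "t \<le> x" for t
    using S(4)[OF that] vector_derivative_at unfolding F'_def by metis+
  \<comment> \<open>The derivative \<open>k / (h u)\<^sup>2 / k c\<close> of this function dominates the speed \<open>1 / (h u)\<^sup>2\<close> of \<open>F\<close>.\<close>
  let ?\<phi> = "\<lambda>t. - 1 / (h t * k c)"
  have \<phi>: "(?\<phi> has_real_derivative k t / (h t * u t)\<^sup>2 / k c) (at t)" if "c \<le> t" "t \<le> x" for t
    using S(1,2)[OF that] c(2)
    by (auto intro!: derivative_eq_intros S(3)[OF that] simp: field_simps power2_eq_square)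
  have "norm (F x - F c) \<le> ?\<phi> x - ?\<phi> c"
  proof (rule differentiable_bound_general[OF cx, where f' = F' and \<phi>' = "\<lambda>t. k t / (h t * u t)\<^sup>2 / k c"])
    show "continuous_on {c..x} F"
      using F'(1) by (auto intro!: continuous_at_imp_continuous_on has_vector_derivative_continuous)
    show "continuous_on {c..x} ?\<phi>"
      using \<phi> by (auto intro!: continuous_at_imp_continuous_on DERIV_isCont)
    fix t assume t: "c < t" "t < x"
    show "(?\<phi> has_vector_derivative k t / (h t * u t)\<^sup>2 / k c) (at t)"
      using \<phi>[of t] t by (simp add: has_real_derivative_iff_has_vector_derivative)
    show "(F has_vector_derivative F' t) (at t)" using F'(1) t by simp
    show "norm (F' t) \<le> k t / (h t * u t)\<^sup>2 / k c"
      using F'(2)[of t] S(1,2,5)[of t] t c(2) by (simp add: field_simps mult_right_mono)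
  qed
  also have "\<dots> \<le> 1 / (h c * k c)"
    using S(2)[of x] cx c(2) by (simp add: field_simps)
  finally show ?thesis .
qed

lemma sturm_data_not_to_infinity:
  assumes S: "sturm_data a b u h k F" and c: "c \<in> {a<..<b}" "0 < k c"
  shows "\<not> filterlim (\<lambda>x. norm (F x)) at_top (at_left b)"
proof
  assume "filterlim (\<lambda>x. norm (F x)) at_top (at_left b)"
  then have "eventually (\<lambda>x. norm (F x) > norm (F c) + 1 / (h c * k c)) (at_left b)"
    by (simp add: filterlim_at_top_dense)
  moreover have "eventually (\<lambda>x. x \<in> {c<..<b}) (at_left b)"
    using c by (intro eventually_at_leftI[of c]) auto
  ultimately have "eventually (\<lambda>x. norm (F x) > norm (F c) + 1 / (h c * k c) \<and> x \<in> {c<..<b}) (at_left b)"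
    by (rule eventually_conj)
  then obtain x where x: "norm (F x) > norm (F c) + 1 / (h c * k c)" "x \<in> {c<..<b}"
    using eventually_happens'[OF trivial_limit_at_left_real] by blast
  have "norm (F x) \<le> norm (F c) + norm (F x - F c)" by (rule norm_triangle_sub)
  moreover have "norm (F x - F c) \<le> 1 / (h c * k c)"
    by (rule sturm_data_bounded[OF S c]) (use x in auto)
  ultimately show False using x(1) by linarith
qed

lemma sturm_data_reflect:
  assumes S: "sturm_data a b u h k F"
  shows "sturm_data (- b) (- a) (\<lambda>x. u (- x)) (\<lambda>x. h (- x)) (\<lambda>x. - k (- x)) (\<lambda>x. F (- x))"
  unfolding sturm_data_def
proof (intro conjI ballI)
  show "mono_on {- b<..<- a} (\<lambda>x. - k (- x))"
    using S by (auto simp: sturm_data_def mono_on_def)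
  fix x assume "x \<in> {- b<..<- a}"
  then have x: "- x \<in> {a<..<b}" by auto
  show "0 < u (- x)" "0 < h (- x)" using S x by (auto simp: sturm_data_def)
  have "(h has_real_derivative k (- x) / (u (- x))\<^sup>2) (at (- x))"
    using S x by (auto simp: sturm_data_def)
  then show "((\<lambda>x. h (- x)) has_real_derivative - k (- x) / (u (- x))\<^sup>2) (at x)"
    using DERIV_mirror[of h _ x] by simp
  obtain F' where F': "(F has_vector_derivative F') (at (- x))" "norm F' = 1 / (h (- x) * u (- x))\<^sup>2"
    using S x unfolding sturm_data_def by blast
  have "((F \<circ> uminus) has_vector_derivative (- 1) *\<^sub>R F') (at x)"
    by (rule vector_diff_chain_at) (auto intro!: derivative_eq_intros F')
  then show "\<exists>F'. ((\<lambda>x. F (- x)) has_vector_derivative F') (at x) \<and> norm F' = 1 / (h (- x) * u (- x))\<^sup>2"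
    using F'(2) by (intro exI[of _ "- F'"]) (simp add: o_def)
qed

text \<open>If \<open>F\<close> escapes to infinity at both ends, \<open>h\<close> can neither increase nor decrease anywhere.\<close>

lemma sturm_data_flux_zero:
  assumes S: "sturm_data a b u h k F"
    and right: "filterlim (\<lambda>x. norm (F x)) at_top (at_left b)"
    and left: "filterlim (\<lambda>x. norm (F x)) at_top (at_right a)"
    and x: "x \<in> {a<..<b}"
  shows "k x = 0"
proof -
  have "\<not> 0 < k x" using sturm_data_not_to_infinity[OF S x] right by blast
  moreover have "filterlim (\<lambda>x. norm (F (- x))) at_top (at_left (- a))"
    using left by (simp add: filterlim_at_left_to_right)
  then have "\<not> 0 < - k x"
    using sturm_data_not_to_infinity[OF sturm_data_reflect[OF S], of "- x"] x by auto
  ultimately show ?thesis by simp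
qed

text \<open>Here \<open>L = ln w\<close> is the logarithm of \<open>w = \<bar>F'\<bar> powr (-1/2)\<close>, and \<open>l' + l\<^sup>2 + p\<close> equals \<open>(w'' + p w) / w\<close>.
  Logarithms turn the products and powers in \<open>w\<close> into sums and keep \<open>w\<close> out of the calculations.\<close>

definition riccati_data ::
  "(real \<Rightarrow> real) \<Rightarrow> real \<Rightarrow> real \<Rightarrow> (real \<Rightarrow> real) \<Rightarrow> (real \<Rightarrow> real) \<Rightarrow> (real \<Rightarrow> real) \<Rightarrow> (real \<Rightarrow> 'a::real_normed_vector) \<Rightarrow> bool"
  where
  "riccati_data p a b L l l' F \<longleftrightarrow>
     (\<forall>x\<in>{a<..<b}. (L has_real_derivative l x) (at x) \<and> (l has_real_derivative l' x) (at x) \<and>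
        0 \<le> l' x + (l x)\<^sup>2 + p x \<and>
        (\<exists>F'. (F has_vector_derivative F') (at x) \<and> norm F' = exp (- 2 * L x)))"

text \<open>The Wronskian \<open>w' u - w u'\<close> of \<open>w = exp L\<close> and \<open>u\<close>.\<close>

definition flux :: "(real \<Rightarrow> real) \<Rightarrow> (real \<Rightarrow> real) \<Rightarrow> (real \<Rightarrow> real) \<Rightarrow> (real \<Rightarrow> real) \<Rightarrow> real \<Rightarrow> real" where
  "flux u u' L l x = exp (L x) * (l x * u x - u' x)"

lemma flux_derivative:
  assumes "(u has_real_derivative u' x) (at x)" "(u' has_real_derivative - (p x * u x)) (at x)"
    "(L has_real_derivative l x) (at x)" "(l has_real_derivative l' x) (at x)"
  shows "(flux u u' L l has_real_derivative exp (L x) * u x * (l' x + (l x)\<^sup>2 + p x)) (at x)"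
  unfolding flux_def using assms
  by (auto intro!: derivative_eq_intros simp: power2_eq_square algebra_simps)

text \<open>Sturm comparison: the Wronskian of \<open>w\<close> and \<open>u\<close> has derivative \<open>u (w'' + p w) \<ge> 0\<close>, and it is \<open>u\<^sup>2\<close>
  times the derivative of \<open>w / u\<close>.\<close>

lemma riccati_sturm_data:
  assumes u: "positive_solution p u u'" and R: "riccati_data p a b L l l' F"
    and ab: "-1 \<le> a" "b \<le> 1"
  shows "sturm_data a b u (\<lambda>x. exp (L x) / u x) (flux u u' L l) F"
  unfolding sturm_data_def
proof (intro conjI ballI)
  have I: "x \<in> {-1<..<1}" if "x \<in> {a<..<b}" for x using that ab by auto
  have D: "(flux u u' L l has_real_derivative exp (L x) * u x * (l' x + (l x)\<^sup>2 + p x)) (at x)"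
    if "x \<in> {a<..<b}" for x
    using that I[OF that] u R by (intro flux_derivative) (auto simp: positive_solution_def riccati_data_def)
  show "mono_on {a<..<b} (flux u u' L l)"
  proof (rule mono_onI)
    fix x y assume xy: "x \<in> {a<..<b}" "y \<in> {a<..<b}" "x \<le> y"
    show "flux u u' L l x \<le> flux u u' L l y"
    proof (rule DERIV_nonneg_imp_nondecreasing[OF xy(3)])
      fix t assume "x \<le> t" "t \<le> y"
      then have t: "t \<in> {a<..<b}" using xy by auto
      have "0 \<le> exp (L t) * u t * (l' t + (l t)\<^sup>2 + p t)"
        using R u t I[OF t] unfolding riccati_data_def positive_solution_def
        by (intro mult_nonneg_nonneg) (auto intro: less_imp_le)
      then show "\<exists>d. (flux u u' L l has_real_derivative d) (at t) \<and> 0 \<le> d"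
        using D[OF t] by blast
    qed
  qed
  fix x assume x: "x \<in> {a<..<b}"
  note ux = u[unfolded positive_solution_def, rule_format, OF I[OF x]]
  note Rx = R[unfolded riccati_data_def, rule_format, OF x]
  show "0 < u x" "0 < exp (L x) / u x" using ux by auto
  show "((\<lambda>x. exp (L x) / u x) has_real_derivative flux u u' L l x / (u x)\<^sup>2) (at x)"
    using ux Rx by (auto intro!: derivative_eq_intros simp: flux_def field_simps power2_eq_square)
  have "exp (- 2 * L x) = 1 / (exp (L x) / u x * u x)\<^sup>2"
    using ux by (simp add: exp_minus divide_inverse exp_double)
  then show "\<exists>F'. (F has_vector_derivative F') (at x) \<and> norm F' = 1 / (exp (L x) / u x * u x)\<^sup>2"
    using Rx by simp
qed

text \<open>With the Wronskian identically zero, \<open>w / u\<close> is constant and the inequality \<open>w'' + p w \<ge> 0\<close> is an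
  equality.\<close>

lemma riccati_rigidity:
  assumes u: "positive_solution p u u'" and R: "riccati_data p a b L l l' F"
    and ab: "-1 \<le> a" "b \<le> 1"
    and right: "filterlim (\<lambda>x. norm (F x)) at_top (at_left b)"
    and left: "filterlim (\<lambda>x. norm (F x)) at_top (at_right a)"
    and x: "x \<in> {a<..<b}"
  shows "l x = u' x / u x" and "l' x + (l x)\<^sup>2 + p x = 0"
proof -
  have "x \<in> {-1<..<1}" using x ab by auto
  note ux = u[unfolded positive_solution_def, rule_format, OF this]
  note Rx = R[unfolded riccati_data_def, rule_format, OF x]
  have zero: "flux u u' L l t = 0" if "t \<in> {a<..<b}" for t
    by (rule sturm_data_flux_zero[OF riccati_sturm_data[OF u R ab] right left that])
  show "l x = u' x / u x" using zero[OF x] ux by (simp add: flux_def field_simps)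
  have "(flux u u' L l has_real_derivative exp (L x) * u x * (l' x + (l x)\<^sup>2 + p x)) (at x)"
    using ux Rx by (intro flux_derivative) auto
  then have "((\<lambda>t. 0) has_real_derivative exp (L x) * u x * (l' x + (l x)\<^sup>2 + p x)) (at x)"
    by (rule has_field_derivative_transform_within_open[OF _ _ x]) (use zero in auto)
  then have "exp (L x) * u x * (l' x + (l x)\<^sup>2 + p x) = 0"
    using DERIV_unique DERIV_const by blast
  then show "l' x + (l x)\<^sup>2 + p x = 0" using ux by simp
qed

text \<open>The velocity equation makes \<open>u\<^sup>2 F'\<close> a constant vector \<open>B\<close>, so \<open>F\<close> moves along a straight line in
  the direction \<open>B\<close>; it covers the whole line because it is unbounded at both ends of the interval.\<close>

lemma velocity_proportional_line:
  fixes F F1 :: "real \<Rightarrow> 'a::real_inner"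
  assumes u: "positive_solution p u u'"
    and F: "\<And>x. x \<in> {-1<..<1} \<Longrightarrow> (F has_vector_derivative F1 x) (at x)"
    and F1: "\<And>x. x \<in> {-1<..<1} \<Longrightarrow> (F1 has_vector_derivative (- 2 * (u' x / u x)) *\<^sub>R F1 x) (at x)"
    and nonzero: "\<And>x. x \<in> {-1<..<1} \<Longrightarrow> F1 x \<noteq> 0"
    and right: "filterlim (\<lambda>x. norm (F x)) at_top (at_left 1)"
    and left: "filterlim (\<lambda>x. norm (F x)) at_top (at_right (-1))"
  obtains A B where "B \<noteq> 0" "F ` {-1<..<1} = range (\<lambda>t. A + t *\<^sub>R B)"
proof -
  let ?I = "{-1<..<1::real}"
  have ux: "0 < u x" "(u has_real_derivative u' x) (at x)" if "x \<in> ?I" for x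
    using u that by (auto simp: positive_solution_def)
  define B where "B = (u 0)\<^sup>2 *\<^sub>R F1 0"
  have B0: "B \<noteq> 0" using nonzero[of 0] ux(1)[of 0] by (simp add: B_def)
  have const: "(u x)\<^sup>2 *\<^sub>R F1 x = B" if x: "x \<in> ?I" for x
  proof -
    have "((\<lambda>x. (u x)\<^sup>2 *\<^sub>R F1 x) has_vector_derivative 0) (at y within ?I)" if "y \<in> ?I" for y
    proof -
      have "((\<lambda>x. (u x)\<^sup>2 *\<^sub>R F1 x) has_vector_derivative
         (u y)\<^sup>2 *\<^sub>R (- 2 * (u' y / u y)) *\<^sub>R F1 y + (2 * u y * u' y) *\<^sub>R F1 y) (at y)"
        by (intro has_vector_derivative_scaleR F1 that)
           (use ux[OF that] in \<open>auto intro!: derivative_eq_intros\<close>)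
      moreover have "(u y)\<^sup>2 *\<^sub>R (- 2 * (u' y / u y)) *\<^sub>R F1 y + (2 * u y * u' y) *\<^sub>R F1 y = 0"
        using ux(1)[OF that] by (simp add: power2_eq_square flip: scaleR_add_left)
      ultimately have "((\<lambda>x. (u x)\<^sup>2 *\<^sub>R F1 x) has_vector_derivative 0) (at y)"
        by (simp only:)
      then show ?thesis by (rule has_vector_derivative_at_within)
    qed
    then obtain c where "\<And>y. y \<in> ?I \<Longrightarrow> (u y)\<^sup>2 *\<^sub>R F1 y = c"
      by (rule has_vector_derivative_zero_constant[rotated]) auto
    then show ?thesis using x by (simp add: B_def)
  qed
  have F1B: "F1 x = (1 / (u x)\<^sup>2) *\<^sub>R B" if "x \<in> ?I" for x
    using ux(1)[OF that] by (simp add: const[OF that, symmetric])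
  \<comment> \<open>\<open>G\<close> is the primitive of \<open>1 / u\<^sup>2\<close>, read off as the coordinate of \<open>F\<close> along \<open>B\<close>.\<close>
  define G where "G x = inner (F x - F 0) B / inner B B" for x
  have G0: "G 0 = 0" by (simp add: G_def)
  have G: "(G has_real_derivative 1 / (u x)\<^sup>2) (at x)" if x: "x \<in> ?I" for x
  proof -
    have "(G has_vector_derivative inner (F1 x) B / inner B B) (at x)"
      unfolding G_def
      by (rule has_vector_derivative_divide, rule bounded_linear.has_vector_derivative[OF bounded_linear_inner_left])
         (auto intro!: derivative_eq_intros F[OF x])
    then show ?thesis
      using B0 by (simp add: F1B[OF x] has_real_derivative_iff_has_vector_derivative)
  qed
  have FG: "F x = F 0 + G x *\<^sub>R B" if x: "x \<in> ?I" for x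
  proof -
    have "((\<lambda>x. F x - G x *\<^sub>R B) has_vector_derivative 0) (at y within ?I)" if y: "y \<in> ?I" for y
    proof -
      have "((\<lambda>x. F x - G x *\<^sub>R B) has_vector_derivative F1 y - (G y *\<^sub>R 0 + (1 / (u y)\<^sup>2) *\<^sub>R B)) (at y)"
        by (intro has_vector_derivative_diff has_vector_derivative_scaleR F G y has_vector_derivative_const)
      then show ?thesis using F1B[OF y] by (simp add: has_vector_derivative_at_within)
    qed
    then obtain c where "\<And>y. y \<in> ?I \<Longrightarrow> F y - G y *\<^sub>R B = c"
      by (rule has_vector_derivative_zero_constant[rotated]) auto
    from this[OF x] this[of 0] have "F x - G x *\<^sub>R B = F 0 - G 0 *\<^sub>R B" by simp
    then show ?thesis by (simp add: G0 diff_eq_eq)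
  qed
  have mono: "G x \<le> G y" if "x \<in> ?I" "y \<in> ?I" "x \<le> y" for x y
  proof (rule DERIV_nonneg_imp_nondecreasing[OF that(3)])
    fix t assume "x \<le> t" "t \<le> y"
    then have "t \<in> ?I" using that by auto
    from G[OF this] show "\<exists>d. (G has_real_derivative d) (at t) \<and> 0 \<le> d" by fastforce
  qed
  have big: "\<bar>t\<bar> < \<bar>G x\<bar>" if "x \<in> ?I" "norm (F 0) + \<bar>t\<bar> * norm B < norm (F x)" for x t
  proof -
    have "norm (F x) \<le> norm (F 0) + \<bar>G x\<bar> * norm B"
      using norm_triangle_ineq[of "F 0" "G x *\<^sub>R B"] FG[OF that(1)] by simp
    then have "\<bar>t\<bar> * norm B < \<bar>G x\<bar> * norm B" using that(2) by linarith
    then show ?thesis by (simp add: mult_less_cancel_right)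
  qed
  have surj: "\<exists>x\<in>?I. G x = t" for t
  proof -
    let ?P = "\<lambda>x. norm (F 0) + \<bar>t\<bar> * norm B < norm (F x)"
    have "eventually (\<lambda>x. ?P x \<and> x \<in> {0<..<1}) (at_left 1)"
      using filterlim_at_top_dense[THEN iffD1, OF right, rule_format]
      by (rule eventually_conj) (rule eventually_at_leftI[of 0]; simp)
    then obtain y where y: "?P y" "y \<in> {0<..<1}"
      using eventually_happens'[OF trivial_limit_at_left_real] by blast
    have "eventually (\<lambda>x. ?P x \<and> x \<in> {-1<..<0}) (at_right (-1))"
      using filterlim_at_top_dense[THEN iffD1, OF left, rule_format]
      by (rule eventually_conj) (rule eventually_at_rightI[of _ 0]; simp)
    then obtain z where z: "?P z" "z \<in> {-1<..<0}"
      using eventually_happens'[OF trivial_limit_at_right_real] by blast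
    have yz: "y \<in> ?I" "z \<in> ?I" "z \<le> y" using y(2) z(2) by auto
    have "0 \<le> G y" "G z \<le> 0" using mono[of 0 y] mono[of z 0] y(2) z(2) G0 by auto
    then have "t \<le> G y" "G z \<le> t" using big[OF yz(1) y(1)] big[OF yz(2) z(1)] by linarith+
    moreover have "continuous_on {z..y} G"
      by (intro continuous_at_imp_continuous_on ballI DERIV_isCont[OF G]) (use y z in auto)
    ultimately obtain x where "z \<le> x" "x \<le> y" "G x = t"
      using IVT'[of G z t y] yz(3) by blast
    then show ?thesis using yz by (intro bexI[of _ x]) auto
  qed
  show ?thesis
  proof (rule that[OF B0])
    show "F ` ?I = range (\<lambda>t. F 0 + t *\<^sub>R B)"
    proof (intro equalityI subsetI)
      fix y assume "y \<in> F ` ?I"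
      then obtain x where "x \<in> ?I" "y = F x" by blast
      then show "y \<in> range (\<lambda>t. F 0 + t *\<^sub>R B)" using FG[of x] by (intro range_eqI[of _ _ "G x"]) simp
    next
      fix y assume "y \<in> range (\<lambda>t. F 0 + t *\<^sub>R B)"
      then obtain t where t: "y = F 0 + t *\<^sub>R B" by blast
      obtain x where x: "x \<in> ?I" "G x = t" using surj by blast
      then show "y \<in> F ` ?I" using FG[OF x(1)] t by (intro image_eqI[OF _ x(1)]) simp
    qed
  qed
qed

section \<open>Curves with bounded Ahlfors Schwarzian\<close>

text \<open>Ahlfors' Schwarzian derivative of a curve with first three derivatives \<open>a\<close>, \<open>b\<close>, \<open>c\<close>. In terms of
  the speed \<open>v\<close> and the curvature \<open>\<kappa>\<close> of the curve it is \<open>(v'/v)' - (v'/v)\<^sup>2/2 + v\<^sup>2 \<kappa>\<^sup>2/2\<close>.\<close>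

definition ahlfors_schwarzian :: "'a::real_inner \<Rightarrow> 'a \<Rightarrow> 'a \<Rightarrow> real" where
  "ahlfors_schwarzian a b c =
     inner a c / inner a a - 3 * (inner a b)\<^sup>2 / (inner a a)\<^sup>2 + 3 / 2 * inner b b / inner a a"

lemma has_real_derivative_inner:
  fixes f g :: "real \<Rightarrow> 'a::real_inner"
  assumes "(f has_vector_derivative f') (at x)" "(g has_vector_derivative g') (at x)"
  shows "((\<lambda>x. inner (f x) (g x)) has_real_derivative inner (f x) g' + inner f' (g x)) (at x)"
  unfolding has_real_derivative_iff_has_vector_derivative
  by (rule bounded_bilinear.has_vector_derivative[OF bounded_bilinear_inner assms])

definition regular_curve :: "real set \<Rightarrow> (real \<Rightarrow> 'a::real_inner) \<Rightarrow> (real \<Rightarrow> 'a) \<Rightarrow> (real \<Rightarrow> 'a) \<Rightarrow> (real \<Rightarrow> 'a) \<Rightarrow> bool"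
  where
  "regular_curve S q q1 q2 q3 \<longleftrightarrow>
     (\<forall>x\<in>S. q1 x \<noteq> 0 \<and> (q has_vector_derivative q1 x) (at x) \<and>
        (q1 has_vector_derivative q2 x) (at x) \<and> (q2 has_vector_derivative q3 x) (at x))"

lemma regular_curve_continuous:
  assumes "regular_curve S q q1 q2 q3"
  shows "continuous_on S q" "continuous_on S q1"
  using assms unfolding regular_curve_def
  by (meson continuous_at_imp_continuous_on has_vector_derivative_continuous)+

lemma regular_curve_subset:
  assumes "regular_curve S q q1 q2 q3" "S' \<subseteq> S"
  shows "regular_curve S' q q1 q2 q3"
  using assms unfolding regular_curve_def by blast

lemma norm_eq_exp_ln:
  fixes v :: "'a::real_inner"
  assumes "v \<noteq> 0"
  shows "norm v = exp (- 2 * (- ln (inner v v) / 4))"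
  using assms by (simp add: dot_square_norm ln_realpow)

lemma norm_rejection_squared:
  fixes a b :: "'a::real_inner"
  assumes "inner a a \<noteq> 0"
  shows "(norm (b - (inner a b / inner a a) *\<^sub>R a))\<^sup>2 = inner b b - (inner a b)\<^sup>2 / inner a a"
  using assms unfolding power2_norm_eq_inner
  by (simp add: inner_diff_left inner_diff_right inner_commute[of b a] power2_eq_square)

lemma curve_riccati_identity:
  fixes N A C E :: real
  assumes "N \<noteq> 0"
  shows "- (E + C) / (2 * N) + A\<^sup>2 / N\<^sup>2 + (- A / (2 * N))\<^sup>2 + p =
    p - (C / N - 3 * A\<^sup>2 / N\<^sup>2 + 3 / 2 * E / N) / 2 + (E - A\<^sup>2 / N) / (4 * N)"
  using assms by (simp add: field_simps power2_eq_square)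

lemma curve_log_derivative_identity:
  fixes N A C E :: real
  assumes "N \<noteq> 0"
  shows "(- (C + E) * (2 * N) - - A * (2 * (2 * A))) / ((2 * N) * (2 * N)) = - (E + C) / (2 * N) + A\<^sup>2 / N\<^sup>2"
  using assms by (simp add: divide_simps) algebra

text \<open>With \<open>w = \<bar>q'\<bar> powr (-1/2)\<close>, the quotient \<open>w'' / w\<close> equals minus half the Ahlfors Schwarzian plus a
  square that measures the part of the acceleration orthogonal to the velocity, that is, the curvature.\<close>

lemma curve_riccati_data:
  assumes C: "regular_curve {a<..<b} q q1 q2 q3"
    and S: "\<And>x. x \<in> {a<..<b} \<Longrightarrow> ahlfors_schwarzian (q1 x) (q2 x) (q3 x) \<le> 2 * p x"
  defines "L \<equiv> \<lambda>x. - ln (inner (q1 x) (q1 x)) / 4"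
    and "l \<equiv> \<lambda>x. - inner (q1 x) (q2 x) / (2 * inner (q1 x) (q1 x))"
  obtains l' where "riccati_data p a b L l l' q"
    "\<And>x. x \<in> {a<..<b} \<Longrightarrow> l' x + (l x)\<^sup>2 + p x =
       p x - ahlfors_schwarzian (q1 x) (q2 x) (q3 x) / 2 +
       (norm (q2 x - (inner (q1 x) (q2 x) / inner (q1 x) (q1 x)) *\<^sub>R q1 x))\<^sup>2 / (4 * inner (q1 x) (q1 x))"
proof -
  define l' where "l' x =
     - (inner (q2 x) (q2 x) + inner (q1 x) (q3 x)) / (2 * inner (q1 x) (q1 x))
     + (inner (q1 x) (q2 x))\<^sup>2 / (inner (q1 x) (q1 x))\<^sup>2" for x
  have eq: "l' x + (l x)\<^sup>2 + p x =
       p x - ahlfors_schwarzian (q1 x) (q2 x) (q3 x) / 2 +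
       (norm (q2 x - (inner (q1 x) (q2 x) / inner (q1 x) (q1 x)) *\<^sub>R q1 x))\<^sup>2 / (4 * inner (q1 x) (q1 x))"
    if x: "x \<in> {a<..<b}" for x
  proof -
    have N: "inner (q1 x) (q1 x) \<noteq> 0" using C x by (simp add: regular_curve_def)
    show ?thesis using N
      unfolding l'_def l_def ahlfors_schwarzian_def norm_rejection_squared[OF N] by (rule curve_riccati_identity)
  qed
  have "riccati_data p a b L l l' q"
    unfolding riccati_data_def
  proof (intro ballI conjI)
    fix x assume x: "x \<in> {a<..<b}"
    have q1: "q1 x \<noteq> 0" and q: "(q has_vector_derivative q1 x) (at x)"
      "(q1 has_vector_derivative q2 x) (at x)" "(q2 has_vector_derivative q3 x) (at x)"
      using C x by (auto simp: regular_curve_def)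
    have N: "0 < inner (q1 x) (q1 x)" using q1 by simp
    have dN: "((\<lambda>x. inner (q1 x) (q1 x)) has_real_derivative 2 * inner (q1 x) (q2 x)) (at x)"
      and dA: "((\<lambda>x. - inner (q1 x) (q2 x)) has_real_derivative - (inner (q1 x) (q3 x) + inner (q2 x) (q2 x))) (at x)"
      using has_real_derivative_inner[OF q(2) q(2)] DERIV_minus[OF has_real_derivative_inner[OF q(2) q(3)]]
      by (simp_all add: inner_commute)
    have "(L has_real_derivative - (inverse (inner (q1 x) (q1 x)) * (2 * inner (q1 x) (q2 x))) / 4) (at x)"
      unfolding L_def by (intro DERIV_cdivide DERIV_minus DERIV_chain2[OF DERIV_ln dN] N)
    then show "(L has_real_derivative l x) (at x)" by (simp add: l_def inverse_eq_divide)
    have "(l has_real_derivative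
        (- (inner (q1 x) (q3 x) + inner (q2 x) (q2 x)) * (2 * inner (q1 x) (q1 x))
            - - inner (q1 x) (q2 x) * (2 * (2 * inner (q1 x) (q2 x))))
          / ((2 * inner (q1 x) (q1 x)) * (2 * inner (q1 x) (q1 x)))) (at x)"
      unfolding l_def using N by (intro DERIV_divide DERIV_cmult dN dA) auto
    moreover have "(- (inner (q1 x) (q3 x) + inner (q2 x) (q2 x)) * (2 * inner (q1 x) (q1 x))
            - - inner (q1 x) (q2 x) * (2 * (2 * inner (q1 x) (q2 x))))
          / ((2 * inner (q1 x) (q1 x)) * (2 * inner (q1 x) (q1 x))) = l' x"
      using N unfolding l'_def by (intro curve_log_derivative_identity) auto
    ultimately show "(l has_real_derivative l' x) (at x)" by simp
    show "0 \<le> l' x + (l x)\<^sup>2 + p x"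
      unfolding eq[OF x] using S[OF x] N by (intro add_nonneg_nonneg divide_nonneg_nonneg) auto
    show "\<exists>F'. (q has_vector_derivative F') (at x) \<and> norm F' = exp (- 2 * L x)"
      using q(1) norm_eq_exp_ln[OF q1] unfolding L_def by blast
  qed
  then show ?thesis using eq by (rule that)
qed

text \<open>The case of a cut point at infinity. Equality in the Riccati inequality makes both nonnegative terms of
  the defect vanish: the Schwarzian bound is sharp, and the acceleration is parallel to the velocity.\<close>

lemma curve_rigidity:
  fixes q :: "real \<Rightarrow> 'a::real_inner"
  assumes u: "positive_solution p u u'"
    and C: "regular_curve {-1<..<1} q q1 q2 q3"
    and S: "\<And>x. x \<in> {-1<..<1} \<Longrightarrow> ahlfors_schwarzian (q1 x) (q2 x) (q3 x) \<le> 2 * p x"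
    and right: "filterlim (\<lambda>x. norm (q x)) at_top (at_left 1)"
    and left: "filterlim (\<lambda>x. norm (q x)) at_top (at_right (-1))"
  obtains A B where "B \<noteq> 0" "q ` {-1<..<1} = range (\<lambda>t. A + t *\<^sub>R B)"
    "\<And>x. x \<in> {-1<..<1} \<Longrightarrow> ahlfors_schwarzian (q1 x) (q2 x) (q3 x) = 2 * p x"
proof -
  let ?I = "{-1<..<1::real}"
  let ?N = "\<lambda>x. inner (q1 x) (q1 x)"
  let ?L = "\<lambda>x. - ln (?N x) / 4" and ?l = "\<lambda>x. - inner (q1 x) (q2 x) / (2 * ?N x)"
  obtain l' where R: "riccati_data p (-1) 1 ?L ?l l' q"
    and eq: "\<And>x. x \<in> ?I \<Longrightarrow> l' x + (?l x)\<^sup>2 + p x =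
       p x - ahlfors_schwarzian (q1 x) (q2 x) (q3 x) / 2 +
       (norm (q2 x - (inner (q1 x) (q2 x) / ?N x) *\<^sub>R q1 x))\<^sup>2 / (4 * ?N x)"
    by (rule curve_riccati_data[OF C S]) (assumption, (rule that; blast))
  have l: "?l x = u' x / u x" and zero: "l' x + (?l x)\<^sup>2 + p x = 0" if "x \<in> ?I" for x
    using riccati_rigidity[OF u R order_refl order_refl right left that] by auto
  have C': "q1 x \<noteq> 0" "(q has_vector_derivative q1 x) (at x)" "(q1 has_vector_derivative q2 x) (at x)" if "x \<in> ?I" for x
    using C that by (auto simp: regular_curve_def)
  have both: "ahlfors_schwarzian (q1 x) (q2 x) (q3 x) = 2 * p x \<and> q2 x = (inner (q1 x) (q2 x) / ?N x) *\<^sub>R q1 x"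
    if x: "x \<in> ?I" for x
  proof -
    have N: "0 < ?N x" using C'(1)[OF x] by simp
    let ?Y = "q2 x - (inner (q1 x) (q2 x) / ?N x) *\<^sub>R q1 x"
    have "0 \<le> (norm ?Y)\<^sup>2 / (4 * ?N x)" using N by simp
    then have "(norm ?Y)\<^sup>2 / (4 * ?N x) = 0" "ahlfors_schwarzian (q1 x) (q2 x) (q3 x) = 2 * p x"
      using eq[OF x] zero[OF x] S[OF x] by linarith+
    then show ?thesis using N by simp
  qed
  have "(q1 has_vector_derivative (- 2 * (u' x / u x)) *\<^sub>R q1 x) (at x)" if x: "x \<in> ?I" for x
  proof -
    have "q2 x = (- 2 * (u' x / u x)) *\<^sub>R q1 x"
      using both[OF x] unfolding l[OF x, symmetric] by simp
    then show ?thesis using C'(3)[OF x] by simp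
  qed
  from velocity_proportional_line[OF u C'(2) this C'(1) right left]
  obtain A B where "B \<noteq> 0" "q ` ?I = range (\<lambda>t. A + t *\<^sub>R B)" by metis
  then show ?thesis using both that by blast
qed

section \<open>Inversion of curves\<close>

definition inversion :: "'a::real_inner \<Rightarrow> 'a" where
  "inversion v = (1 / inner v v) *\<^sub>R v"

text \<open>The differential at \<open>q\<close> of the inversion in the unit sphere, applied to \<open>v\<close>.\<close>

definition inverted_velocity :: "'a::real_inner \<Rightarrow> 'a \<Rightarrow> 'a" where
  "inverted_velocity q v = (1 / inner q q) *\<^sub>R v - (2 * inner q v / (inner q q)\<^sup>2) *\<^sub>R q"

lemma norm_inversion: "norm (inversion v) = 1 / norm v"
  by (simp add: inversion_def dot_square_norm power2_eq_square)

lemma inversion_inversion: "inversion (inversion v) = v"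
  by (cases "v = 0") (simp_all add: inversion_def)

lemma norm_inverted_velocity:
  assumes "q \<noteq> 0" shows "norm (inverted_velocity q v) = norm v / inner q q"
proof -
  define R where "R = inner q q"
  have R: "R \<noteq> 0" using assms by (simp add: R_def)
  have "inner (inverted_velocity q v) (inverted_velocity q v) = inner v v / R\<^sup>2"
    using R unfolding inverted_velocity_def R_def[symmetric]
    by (simp add: inner_diff_left inner_diff_right inner_commute[of v q] power2_eq_square diff_divide_distrib flip: R_def)
  then have "(norm (inverted_velocity q v))\<^sup>2 = (norm v / inner q q)\<^sup>2"
    unfolding power_divide power2_norm_eq_inner by (simp add: R_def)
  then show ?thesis by (simp add: power2_eq_iff_nonneg)
qed

lemma has_vector_derivative_inversion:
  assumes "(q has_vector_derivative q1) (at x)" "q x \<noteq> 0"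
  shows "((\<lambda>x. inversion (q x)) has_vector_derivative inverted_velocity (q x) q1) (at x)"
proof -
  have R: "inner (q x) (q x) \<noteq> 0" using assms by simp
  have "((\<lambda>x. inner (q x) (q x)) has_real_derivative 2 * inner (q x) q1) (at x)"
    using has_real_derivative_inner[OF assms(1) assms(1)] by (simp add: inner_commute)
  from DERIV_inverse_fun[OF this R]
  have "((\<lambda>x. 1 / inner (q x) (q x)) has_real_derivative - (2 * inner (q x) q1 / (inner (q x) (q x))\<^sup>2)) (at x)"
    by (simp add: inverse_eq_divide power2_eq_square)
  from has_vector_derivative_scaleR[OF this assms(1)]
  have "((\<lambda>x. inversion (q x)) has_vector_derivative
      (1 / inner (q x) (q x)) *\<^sub>R q1 + (- (2 * inner (q x) q1 / (inner (q x) (q x))\<^sup>2)) *\<^sub>R q x) (at x)"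
    unfolding inversion_def .
  then show ?thesis by (simp add: inverted_velocity_def)
qed

lemma norm_inversion_at_top:
  assumes "(q \<longlongrightarrow> 0) F" "eventually (\<lambda>x. q x \<noteq> 0) F"
  shows "filterlim (\<lambda>x. norm (inversion (q x))) at_top F"
proof -
  have "filterlim (\<lambda>x. inverse (norm (q x))) at_top F"
    using assms by (intro filterlim_inverse_at_top tendsto_norm_zero) (auto elim: eventually_mono)
  then show ?thesis by (simp add: norm_inversion inverse_eq_divide)
qed

lemma inverted_riccati_identity:
  fixes N A C E R q a :: real
  assumes "N \<noteq> 0" "R \<noteq> 0"
  shows "(N + a) / R - 2 * q\<^sup>2 / R\<^sup>2 - (E + C) / (2 * N) + A\<^sup>2 / N\<^sup>2 + (q / R - A / (2 * N))\<^sup>2 + p =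
    p - (C / N - 3 * A\<^sup>2 / N\<^sup>2 + 3 / 2 * E / N) / 2 + ((E + 4 * N / R * a + 4 * N\<^sup>2 / R) - (A + 2 * N / R * q)\<^sup>2 / N) / (4 * N)"
  using assms by (simp add: divide_simps) algebra

lemma inverted_log_derivative_identity:
  fixes N A C E R q a :: real
  assumes "N \<noteq> 0" "R \<noteq> 0"
  shows "((a + N) * R - q * (2 * q)) / (R * R) - ((C + E) * (2 * N) - A * (2 * (2 * A))) / ((2 * N) * (2 * N))
  = (N + a) / R - 2 * q\<^sup>2 / R\<^sup>2 - (E + C) / (2 * N) + A\<^sup>2 / N\<^sup>2"
  using assms by (simp add: divide_simps) algebra

text \<open>The Ahlfors Schwarzian is invariant under inversion, so the previous identity for the inverted curve
  has the same shape in terms of the original one: \<open>w\<close> is now \<open>\<bar>q\<bar> / sqrt \<bar>q'\<bar>\<close>, and the square is that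
  of the curvature of the inverted curve. It vanishes when \<open>X\<close> is parallel to \<open>q'\<close>.\<close>

lemma inverted_curve_riccati_data:
  assumes C: "regular_curve {a<..<b} q q1 q2 q3"
    and nz: "\<And>x. x \<in> {a<..<b} \<Longrightarrow> q x \<noteq> 0"
    and S: "\<And>x. x \<in> {a<..<b} \<Longrightarrow> ahlfors_schwarzian (q1 x) (q2 x) (q3 x) \<le> 2 * p x"
  defines "L \<equiv> \<lambda>x. ln (inner (q x) (q x)) / 2 - ln (inner (q1 x) (q1 x)) / 4"
    and "l \<equiv> \<lambda>x. inner (q x) (q1 x) / inner (q x) (q x) - inner (q1 x) (q2 x) / (2 * inner (q1 x) (q1 x))"
  obtains l' where "riccati_data p a b L l l' (\<lambda>x. inversion (q x))"
    "\<And>x X. x \<in> {a<..<b} \<Longrightarrow> X = q2 x + (2 * inner (q1 x) (q1 x) / inner (q x) (q x)) *\<^sub>R q x \<Longrightarrow>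
       l' x + (l x)\<^sup>2 + p x = p x - ahlfors_schwarzian (q1 x) (q2 x) (q3 x) / 2 +
       (norm (X - (inner (q1 x) X / inner (q1 x) (q1 x)) *\<^sub>R q1 x))\<^sup>2 / (4 * inner (q1 x) (q1 x))"
proof -
  define l' where "l' x =
     (inner (q1 x) (q1 x) + inner (q x) (q2 x)) / inner (q x) (q x)
     - 2 * (inner (q x) (q1 x))\<^sup>2 / (inner (q x) (q x))\<^sup>2
     - (inner (q2 x) (q2 x) + inner (q1 x) (q3 x)) / (2 * inner (q1 x) (q1 x))
     + (inner (q1 x) (q2 x))\<^sup>2 / (inner (q1 x) (q1 x))\<^sup>2" for x
  have eq: "l' x + (l x)\<^sup>2 + p x = p x - ahlfors_schwarzian (q1 x) (q2 x) (q3 x) / 2 +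
       (norm (X - (inner (q1 x) X / inner (q1 x) (q1 x)) *\<^sub>R q1 x))\<^sup>2 / (4 * inner (q1 x) (q1 x))"
    if x: "x \<in> {a<..<b}" and X: "X = q2 x + (2 * inner (q1 x) (q1 x) / inner (q x) (q x)) *\<^sub>R q x" for x X
  proof -
    have N: "inner (q1 x) (q1 x) \<noteq> 0" "inner (q x) (q x) \<noteq> 0"
      using C nz x by (simp_all add: regular_curve_def)
    have XX: "inner X X = inner (q2 x) (q2 x) + 4 * inner (q1 x) (q1 x) / inner (q x) (q x) * inner (q x) (q2 x)
        + 4 * (inner (q1 x) (q1 x))\<^sup>2 / inner (q x) (q x)"
      using N unfolding X
      by (simp add: inner_add_left inner_add_right inner_commute[of "q2 x" "q x"] power2_eq_square
          distrib_left add_divide_distrib)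
    have qX: "inner (q1 x) X = inner (q1 x) (q2 x) + 2 * inner (q1 x) (q1 x) / inner (q x) (q x) * inner (q x) (q1 x)"
      unfolding X by (simp add: inner_add_right inner_commute[of "q1 x" "q x"])
    show ?thesis using N
      unfolding l'_def l_def ahlfors_schwarzian_def norm_rejection_squared[OF N(1)] unfolding XX qX
      by (rule inverted_riccati_identity)
  qed
  have "riccati_data p a b L l l' (\<lambda>x. inversion (q x))"
    unfolding riccati_data_def
  proof (intro ballI conjI)
    fix x assume x: "x \<in> {a<..<b}"
    have q1: "q1 x \<noteq> 0" and q: "(q has_vector_derivative q1 x) (at x)"
      "(q1 has_vector_derivative q2 x) (at x)" "(q2 has_vector_derivative q3 x) (at x)"
      using C x by (auto simp: regular_curve_def)
    have N: "0 < inner (q1 x) (q1 x)" "0 < inner (q x) (q x)" using q1 nz[OF x] by simp_all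
    have dR: "((\<lambda>x. inner (q x) (q x)) has_real_derivative 2 * inner (q x) (q1 x)) (at x)"
      and dN: "((\<lambda>x. inner (q1 x) (q1 x)) has_real_derivative 2 * inner (q1 x) (q2 x)) (at x)"
      and dq: "((\<lambda>x. inner (q x) (q1 x)) has_real_derivative inner (q x) (q2 x) + inner (q1 x) (q1 x)) (at x)"
      and dA: "((\<lambda>x. inner (q1 x) (q2 x)) has_real_derivative inner (q1 x) (q3 x) + inner (q2 x) (q2 x)) (at x)"
      using has_real_derivative_inner[OF q(1) q(1)] has_real_derivative_inner[OF q(2) q(2)]
        has_real_derivative_inner[OF q(1) q(2)] has_real_derivative_inner[OF q(2) q(3)]
      by (simp_all add: inner_commute)
    have "(L has_real_derivative inverse (inner (q x) (q x)) * (2 * inner (q x) (q1 x)) / 2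
        - inverse (inner (q1 x) (q1 x)) * (2 * inner (q1 x) (q2 x)) / 4) (at x)"
      unfolding L_def
      by (intro DERIV_diff DERIV_cdivide DERIV_chain2[OF DERIV_ln dN] DERIV_chain2[OF DERIV_ln dR] N)
    then show "(L has_real_derivative l x) (at x)" by (simp add: l_def inverse_eq_divide)
    have "(l has_real_derivative
        ((inner (q x) (q2 x) + inner (q1 x) (q1 x)) * inner (q x) (q x) - inner (q x) (q1 x) * (2 * inner (q x) (q1 x)))
          / (inner (q x) (q x) * inner (q x) (q x))
        - ((inner (q1 x) (q3 x) + inner (q2 x) (q2 x)) * (2 * inner (q1 x) (q1 x))
            - inner (q1 x) (q2 x) * (2 * (2 * inner (q1 x) (q2 x))))
          / ((2 * inner (q1 x) (q1 x)) * (2 * inner (q1 x) (q1 x)))) (at x)"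
      unfolding l_def using N by (intro DERIV_diff DERIV_divide DERIV_cmult dR dN dq dA) auto
    moreover have "((inner (q x) (q2 x) + inner (q1 x) (q1 x)) * inner (q x) (q x) - inner (q x) (q1 x) * (2 * inner (q x) (q1 x)))
          / (inner (q x) (q x) * inner (q x) (q x))
        - ((inner (q1 x) (q3 x) + inner (q2 x) (q2 x)) * (2 * inner (q1 x) (q1 x))
            - inner (q1 x) (q2 x) * (2 * (2 * inner (q1 x) (q2 x))))
          / ((2 * inner (q1 x) (q1 x)) * (2 * inner (q1 x) (q1 x))) = l' x"
      using N unfolding l'_def by (intro inverted_log_derivative_identity) auto
    ultimately show "(l has_real_derivative l' x) (at x)" by simp
    show "0 \<le> l' x + (l x)\<^sup>2 + p x"
      unfolding eq[OF x refl] using S[OF x] N by (intro add_nonneg_nonneg divide_nonneg_nonneg) auto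
    have "norm (q1 x) / inner (q x) (q x) = exp (- 2 * L x)"
    proof -
      have "- 2 * L x = - ln (inner (q x) (q x)) + - 2 * (- ln (inner (q1 x) (q1 x)) / 4)"
        by (simp add: L_def)
      then have "exp (- 2 * L x) = exp (- ln (inner (q x) (q x))) * exp (- 2 * (- ln (inner (q1 x) (q1 x)) / 4))"
        by (simp only: exp_add)
      then show ?thesis
        using N(2) by (simp only: norm_eq_exp_ln[OF q1, symmetric] exp_minus exp_ln) (simp add: field_simps)
    qed
    then show "\<exists>F'. ((\<lambda>x. inversion (q x)) has_vector_derivative F') (at x) \<and> norm F' = exp (- 2 * L x)"
      using has_vector_derivative_inversion[OF q(1) nz[OF x]] norm_inverted_velocity[OF nz[OF x]]
      by metis
  qed
  then show ?thesis using eq by (rule that)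
qed

text \<open>If the inverted curve has no curvature, its acceleration is parallel to its velocity, and the factor is
  determined by the rate of change \<open>- 2 l\<close> of the logarithm of the speed.\<close>

lemma inverted_velocity_derivative:
  fixes q q1 q2 :: "real \<Rightarrow> 'a::real_inner"
  assumes q: "(q has_vector_derivative q1 x) (at x)" "(q1 has_vector_derivative q2 x) (at x)"
    and nz: "q x \<noteq> 0" "q1 x \<noteq> 0"
    and X: "X = q2 x + (2 * inner (q1 x) (q1 x) / inner (q x) (q x)) *\<^sub>R q x"
    and par: "X = (inner (q1 x) X / inner (q1 x) (q1 x)) *\<^sub>R q1 x"
  defines "l \<equiv> inner (q x) (q1 x) / inner (q x) (q x) - inner (q1 x) (q2 x) / (2 * inner (q1 x) (q1 x))"
  shows "((\<lambda>x. inverted_velocity (q x) (q1 x)) has_vector_derivative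
      (- 2 * l) *\<^sub>R inverted_velocity (q x) (q1 x)) (at x)"
proof -
  define R where "R = inner (q x) (q x)"
  define N where "N = inner (q1 x) (q1 x)"
  define a where "a = inner (q x) (q1 x)"
  define \<mu> where "\<mu> = inner (q1 x) X / N"
  have R: "R \<noteq> 0" and N: "N \<noteq> 0" using nz by (simp_all add: R_def N_def)
  have q2: "q2 x = \<mu> *\<^sub>R q1 x - (2 * N / R) *\<^sub>R q x"
  proof -
    have X\<mu>: "X = \<mu> *\<^sub>R q1 x" unfolding \<mu>_def N_def by (rule par)
    have "q2 x = X - (2 * N / R) *\<^sub>R q x" using X by (simp add: N_def R_def)
    then show ?thesis unfolding X\<mu> .
  qed
  \<comment> \<open>All coefficients are expressed by \<open>R\<close>, \<open>N\<close>, \<open>a\<close>, \<open>\<mu>\<close>; the derivative is then \<open>\<mu> - 4 a / R\<close> times the inverted velocity.\<close>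
  have "inner (q1 x) (q2 x) = \<mu> * N - 2 * N / R * a"
    by (simp add: q2 inner_diff_right N_def a_def inner_commute)
  then have l: "- 2 * l = \<mu> - 4 * a / R"
    using R N by (simp add: l_def flip: a_def R_def N_def) (simp add: field_simps)
  have a': "inner (q x) (q2 x) = \<mu> * a - 2 * N"
    using R by (simp add: q2 inner_diff_right a_def R_def)
  have dR: "((\<lambda>x. inner (q x) (q x)) has_real_derivative 2 * a) (at x)"
    using has_real_derivative_inner[OF q(1) q(1)] by (simp add: a_def inner_commute)
  have da: "((\<lambda>x. 2 * inner (q x) (q1 x)) has_real_derivative 2 * (\<mu> * a - N)) (at x)"
    using DERIV_cmult[OF has_real_derivative_inner[OF q(1) q(2)], of 2] by (simp add: a' N_def algebra_simps)
  have "((\<lambda>x. 1 / inner (q x) (q x)) has_real_derivative - (2 * a) / R\<^sup>2) (at x)"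
    using DERIV_inverse_fun[OF dR] R by (simp add: R_def inverse_eq_divide power2_eq_square)
  moreover have "((\<lambda>x. 2 * inner (q x) (q1 x) / (inner (q x) (q x))\<^sup>2) has_real_derivative
      (2 * (\<mu> * a - N)) / R\<^sup>2 - 8 * a\<^sup>2 / R ^ 3) (at x)"
  proof -
    have "((\<lambda>x. (inner (q x) (q x))\<^sup>2) has_real_derivative 2 * (2 * a * R)) (at x)"
      using DERIV_power[OF dR, of 2] by (simp add: R_def)
    from DERIV_divide[OF da this]
    have "((\<lambda>x. 2 * inner (q x) (q1 x) / (inner (q x) (q x))\<^sup>2) has_real_derivative
      (2 * (\<mu> * a - N) * R\<^sup>2 - 2 * a * (2 * (2 * a * R))) / (R\<^sup>2 * R\<^sup>2)) (at x)"
      using R by (simp add: R_def a_def)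
    moreover have "(2 * (\<mu> * a - N) * R\<^sup>2 - 2 * a * (2 * (2 * a * R))) / (R\<^sup>2 * R\<^sup>2) =
      (2 * (\<mu> * a - N)) / R\<^sup>2 - 8 * a\<^sup>2 / R ^ 3"
      using R by (simp add: field_simps power2_eq_square power3_eq_cube)
    ultimately show ?thesis by simp
  qed
  ultimately have "((\<lambda>x. inverted_velocity (q x) (q1 x)) has_vector_derivative
      ((1 / R) *\<^sub>R q2 x + (- (2 * a) / R\<^sup>2) *\<^sub>R q1 x)
      - ((2 * a / R\<^sup>2) *\<^sub>R q1 x + ((2 * (\<mu> * a - N)) / R\<^sup>2 - 8 * a\<^sup>2 / R ^ 3) *\<^sub>R q x)) (at x)"
    unfolding inverted_velocity_def R_def a_def
    by (intro has_vector_derivative_diff has_vector_derivative_scaleR q)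
  moreover have "((1 / R) *\<^sub>R q2 x + (- (2 * a) / R\<^sup>2) *\<^sub>R q1 x)
      - ((2 * a / R\<^sup>2) *\<^sub>R q1 x + ((2 * (\<mu> * a - N)) / R\<^sup>2 - 8 * a\<^sup>2 / R ^ 3) *\<^sub>R q x)
      = (- 2 * l) *\<^sub>R inverted_velocity (q x) (q1 x)"
  proof -
    define s where "s = 2 * a / R\<^sup>2"
    define d where "d = (2 * (\<mu> * a - N)) / R\<^sup>2 - 8 * a\<^sup>2 / R ^ 3"
    have "((1 / R) *\<^sub>R q2 x + (- (2 * a) / R\<^sup>2) *\<^sub>R q1 x) - ((2 * a / R\<^sup>2) *\<^sub>R q1 x + d *\<^sub>R q x)
      = ((1 / R) *\<^sub>R q2 x - s *\<^sub>R q1 x) - (s *\<^sub>R q1 x + d *\<^sub>R q x)"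
      by (simp add: s_def)
    also have "\<dots> = (1 / R * \<mu> - s - s) *\<^sub>R q1 x + (- (1 / R * (2 * N / R)) - d) *\<^sub>R q x"
      unfolding q2 by (simp only: scaleR_diff_right scaleR_diff_left scaleR_minus_left scaleR_scaleR)
        (simp only: algebra_simps add.right_inverse add_0_right add_0_left)
    also have "1 / R * \<mu> - s - s = (\<mu> - 4 * a / R) * (1 / R)"
      using R by (simp add: s_def field_simps power2_eq_square)
    also have "- (1 / R * (2 * N / R)) - d = - ((\<mu> - 4 * a / R) * (2 * a / R\<^sup>2))"
      using R by (simp add: d_def field_simps power2_eq_square power3_eq_cube)
    finally show ?thesis
      unfolding l inverted_velocity_def R_def[symmetric] a_def[symmetric]
      by (simp add: d_def scaleR_diff_right)
  qed
  ultimately show ?thesis by simp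
qed

text \<open>The case of a finite cut point, placed at the origin: the inversion of the curve escapes to infinity at
  both ends, and the argument for the cut point at infinity applies to it.\<close>

lemma inverted_curve_rigidity:
  fixes q :: "real \<Rightarrow> 'a::real_inner"
  assumes u: "positive_solution p u u'"
    and C: "regular_curve {-1<..<1} q q1 q2 q3"
    and S: "\<And>x. x \<in> {-1<..<1} \<Longrightarrow> ahlfors_schwarzian (q1 x) (q2 x) (q3 x) \<le> 2 * p x"
    and nz: "\<And>x. x \<in> {-1<..<1} \<Longrightarrow> q x \<noteq> 0"
    and q_right: "(q \<longlongrightarrow> 0) (at_left 1)" and q_left: "(q \<longlongrightarrow> 0) (at_right (-1))"
  obtains A B where "B \<noteq> 0" "(\<lambda>x. inversion (q x)) ` {-1<..<1} = range (\<lambda>t. A + t *\<^sub>R B)"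
    "\<And>x. x \<in> {-1<..<1} \<Longrightarrow> ahlfors_schwarzian (q1 x) (q2 x) (q3 x) = 2 * p x"
proof -
  let ?I = "{-1<..<1::real}"
  let ?R = "\<lambda>x. inner (q x) (q x)" and ?N = "\<lambda>x. inner (q1 x) (q1 x)"
  let ?L = "\<lambda>x. ln (?R x) / 2 - ln (?N x) / 4"
  let ?l = "\<lambda>x. inner (q x) (q1 x) / ?R x - inner (q1 x) (q2 x) / (2 * ?N x)"
  have right: "filterlim (\<lambda>x. norm (inversion (q x))) at_top (at_left 1)"
    by (rule norm_inversion_at_top[OF q_right], rule eventually_at_leftI[OF nz]) auto
  have left: "filterlim (\<lambda>x. norm (inversion (q x))) at_top (at_right (-1))"
    by (rule norm_inversion_at_top[OF q_left], rule eventually_at_rightI[OF nz]) auto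
  obtain l' where R: "riccati_data p (-1) 1 ?L ?l l' (\<lambda>x. inversion (q x))"
    and eq: "\<And>x X. x \<in> ?I \<Longrightarrow> X = q2 x + (2 * ?N x / ?R x) *\<^sub>R q x \<Longrightarrow>
       l' x + (?l x)\<^sup>2 + p x = p x - ahlfors_schwarzian (q1 x) (q2 x) (q3 x) / 2 +
       (norm (X - (inner (q1 x) X / ?N x) *\<^sub>R q1 x))\<^sup>2 / (4 * ?N x)"
    by (rule inverted_curve_riccati_data[OF C nz S]) (assumption, assumption, (rule that; blast))
  have l: "?l x = u' x / u x" and zero: "l' x + (?l x)\<^sup>2 + p x = 0" if "x \<in> ?I" for x
    using riccati_rigidity[OF u R order_refl order_refl right left that] by auto
  have C': "q1 x \<noteq> 0" "(q has_vector_derivative q1 x) (at x)" "(q1 has_vector_derivative q2 x) (at x)" if "x \<in> ?I" for x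
    using C that by (auto simp: regular_curve_def)
  have both: "ahlfors_schwarzian (q1 x) (q2 x) (q3 x) = 2 * p x \<and> X = (inner (q1 x) X / ?N x) *\<^sub>R q1 x"
    if x: "x \<in> ?I" and X: "X = q2 x + (2 * ?N x / ?R x) *\<^sub>R q x" for x X
  proof -
    have N: "0 < ?N x" using C'(1)[OF x] by simp
    let ?Y = "X - (inner (q1 x) X / ?N x) *\<^sub>R q1 x"
    have "0 \<le> (norm ?Y)\<^sup>2 / (4 * ?N x)" using N by simp
    then have "(norm ?Y)\<^sup>2 / (4 * ?N x) = 0" "ahlfors_schwarzian (q1 x) (q2 x) (q3 x) = 2 * p x"
      using eq[OF x X] zero[OF x] S[OF x] by linarith+
    then show ?thesis using N by simp
  qed
  let ?F1 = "\<lambda>x. inverted_velocity (q x) (q1 x)"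
  have F1: "(?F1 has_vector_derivative (- 2 * (u' x / u x)) *\<^sub>R ?F1 x) (at x)" if x: "x \<in> ?I" for x
    using inverted_velocity_derivative[of q q1 x q2, OF C'(2,3)[OF x] nz[OF x] C'(1)[OF x] refl conjunct2[OF both[OF x refl]]]
    unfolding l[OF x] .
  have F1_nz: "?F1 x \<noteq> 0" if x: "x \<in> ?I" for x
  proof -
    have "0 < norm (?F1 x)"
      unfolding norm_inverted_velocity[OF nz[OF x]] using nz[OF x] C'(1)[OF x] by simp
    then show ?thesis by simp
  qed
  obtain A B where "B \<noteq> 0" "(\<lambda>x. inversion (q x)) ` ?I = range (\<lambda>t. A + t *\<^sub>R B)"
    by (rule velocity_proportional_line[OF u has_vector_derivative_inversion[OF C'(2) nz] F1 F1_nz right left])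
  then show ?thesis using both that by blast
qed

text \<open>Inverted, an arc between two zeros of \<open>q\<close> escapes to infinity at both ends, hence \<open>w / u\<close> is constant
  along it. But \<open>w = \<bar>q\<bar> / sqrt \<bar>q'\<bar>\<close> tends to \<open>0\<close> at the end \<open>a\<close>, where \<open>u\<close> stays positive because \<open>a\<close>
  lies inside the interval.\<close>

lemma no_arc_between_zeros:
  fixes q :: "real \<Rightarrow> 'a::real_inner"
  assumes u: "positive_solution p u u'"
    and C: "regular_curve {-1<..<1} q q1 q2 q3"
    and S: "\<And>x. x \<in> {-1<..<1} \<Longrightarrow> ahlfors_schwarzian (q1 x) (q2 x) (q3 x) \<le> 2 * p x"
    and ab: "-1 < a" "a < b" "b \<le> 1" and nz: "\<And>x. x \<in> {a<..<b} \<Longrightarrow> q x \<noteq> 0"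
    and qa: "q a = 0" and qb: "(q \<longlongrightarrow> 0) (at_left b)"
  shows False
proof -
  have sub: "{a<..<b} \<subseteq> {-1<..<1}" and aI: "a \<in> {-1<..<1}" using ab by auto
  let ?R = "\<lambda>x. inner (q x) (q x)" and ?N = "\<lambda>x. inner (q1 x) (q1 x)"
  let ?L = "\<lambda>x. ln (?R x) / 2 - ln (?N x) / 4"
  let ?l = "\<lambda>x. inner (q x) (q1 x) / ?R x - inner (q1 x) (q2 x) / (2 * ?N x)"
  obtain l' where R: "riccati_data p a b ?L ?l l' (\<lambda>x. inversion (q x))"
    by (rule inverted_curve_riccati_data[OF regular_curve_subset[OF C sub] nz S]) (use sub in auto)
  have isC: "isCont q a" "isCont q1 a" "isCont u a"
    using regular_curve_continuous[OF C] aI DERIV_isCont[of u "u' a" a] u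
    by (simp_all add: continuous_on_eq_continuous_at positive_solution_def)
  have right: "filterlim (\<lambda>x. norm (inversion (q x))) at_top (at_left b)"
    by (rule norm_inversion_at_top[OF qb], rule eventually_at_leftI[OF nz ab(2)])
  have "(q \<longlongrightarrow> 0) (at_right a)"
    using isC(1) qa by (auto simp: isCont_def intro: filterlim_mono[OF _ order_refl at_le])
  then have left: "filterlim (\<lambda>x. norm (inversion (q x))) at_top (at_right a)"
    by (rule norm_inversion_at_top, intro eventually_at_rightI[OF nz ab(2)])
  have l: "?l x = u' x / u x" if "x \<in> {a<..<b}" for x
    by (rule riccati_rigidity(1)[OF u R _ ab(3) right left that]) (use ab in simp)
  have "((\<lambda>x. exp (?L x) / u x) has_real_derivative 0) (at x within {a<..<b})" if x: "x \<in> {a<..<b}" for x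
  proof -
    have ux: "0 < u x" "(u has_real_derivative u' x) (at x)" using u x sub by (auto simp: positive_solution_def)
    have Lx: "(?L has_real_derivative ?l x) (at x)" using R x unfolding riccati_data_def by blast
    have "((\<lambda>x. exp (?L x) / u x) has_real_derivative
        (exp (?L x) * ?l x * u x - exp (?L x) * u' x) / (u x * u x)) (at x)"
      by (rule DERIV_divide[OF DERIV_fun_exp[OF Lx] ux(2)]) (use ux in simp)
    moreover have "(exp (?L x) * ?l x * u x - exp (?L x) * u' x) / (u x * u x) = 0"
      unfolding l[OF x] using ux(1) by simp
    ultimately have "((\<lambda>x. exp (?L x) / u x) has_real_derivative 0) (at x)" by (simp only:)
    then show ?thesis by (rule has_field_derivative_at_within)
  qed
  then obtain k where k: "\<And>x. x \<in> {a<..<b} \<Longrightarrow> exp (?L x) / u x = k"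
    using has_field_derivative_zero_constant[of "{a<..<b}" "\<lambda>x. exp (?L x) / u x"] by (auto simp: convex_real_interval)
  define m where "m = (a + b) / 2"
  have m: "m \<in> {a<..<b}" using ab by (auto simp: m_def)
  have "0 < u m" using u m sub by (auto simp: positive_solution_def)
  then have k0: "k \<noteq> 0" using k[OF m] by auto
  \<comment> \<open>Constancy of \<open>exp L / u\<close>, written without logarithms and roots so that it passes to the limit at the zero \<open>a\<close> of \<open>q\<close>.\<close>
  have fourth: "(?R x)\<^sup>2 = ?N x * (k * u x) ^ 4" if x: "x \<in> {a<..<b}" for x
  proof -
    have pos: "0 < ?R x" "0 < ?N x" "0 < u x"
      using nz[OF x] C u x sub by (auto simp: regular_curve_def positive_solution_def)
    have "exp (?L x) = k * u x" using k[OF x] pos(3) by (simp add: nonzero_divide_eq_eq)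
    moreover have "exp (?L x) ^ 4 = (?R x)\<^sup>2 / ?N x"
    proof -
      have "exp (?L x) ^ 4 = exp (real 4 * ?L x)" by (simp only: exp_of_nat_mult)
      also have "real 4 * ?L x = ln (?R x) + ln (?R x) - ln (?N x)" by simp
      finally show ?thesis using pos by (simp only: exp_add exp_diff exp_ln power2_eq_square)
    qed
    ultimately have "(k * u x) ^ 4 = (?R x)\<^sup>2 / ?N x" by (simp only:)
    then show ?thesis using pos(2) by simp
  qed
  have lim: "(f \<longlongrightarrow> f a) (at_right a)" if "isCont f a" for f :: "real \<Rightarrow> real"
    using that by (auto simp: isCont_def intro: filterlim_mono[OF _ order_refl at_le])
  have "((\<lambda>x. ?N x * (k * u x) ^ 4) \<longlongrightarrow> ?N a * (k * u a) ^ 4) (at_right a)"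
    by (rule lim) (intro continuous_intros isC)
  moreover have "((\<lambda>x. (?R x)\<^sup>2) \<longlongrightarrow> (?R a)\<^sup>2) (at_right a)"
    by (rule lim) (intro continuous_intros isC)
  then have "((\<lambda>x. ?N x * (k * u x) ^ 4) \<longlongrightarrow> (?R a)\<^sup>2) (at_right a)"
    by (rule Lim_transform_eventually) (rule eventually_at_rightI[OF fourth ab(2)])
  ultimately have "?N a * (k * u a) ^ 4 = (?R a)\<^sup>2"
    using tendsto_unique trivial_limit_at_right_real by blast
  moreover have "q1 a \<noteq> 0" "u a \<noteq> 0"
    using bspec[OF C[unfolded regular_curve_def] aI] bspec[OF u[unfolded positive_solution_def] aI] by simp_all
  ultimately show False using qa k0 by simp
qed

section \<open>The Schwarzian and the curvature of a holomorphic curve\<close>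

text \<open>The Hermitian inner product, linear in the first argument; its real part is the Euclidean one.\<close>

definition herm :: "complex ^ 'n \<Rightarrow> complex ^ 'n \<Rightarrow> complex" where
  "herm v w = (\<Sum>k\<in>UNIV. v $ k * cnj (w $ k))"

lemma Re_herm: "Re (herm v w) = inner v w"
  by (simp add: herm_def inner_vec_def inner_complex_def)

lemma herm_self: "herm v v = of_real (inner v v)"
  by (simp add: herm_def inner_vec_def inner_complex_def complex_eq_iff mult.commute)

lemma herm_commute: "cnj (herm v w) = herm w v"
  by (simp add: herm_def mult.commute)

lemma herm_linear [simp]:
  "herm (v + v') w = herm v w + herm v' w" "herm (c *s v) w = c * herm v w"
  "herm w (v + v') = herm w v + herm w v'" "herm w (c *s v) = cnj c * herm w v"
  by (simp_all add: herm_def sum.distrib sum_distrib_left algebra_simps)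

lemma bounded_bilinear_herm: "bounded_bilinear (herm :: complex ^ 'n \<Rightarrow> complex ^ 'n \<Rightarrow> complex)"
proof (rule bilinear_conv_bounded_bilinear[THEN iffD1])
  show "bilinear (herm :: complex ^ 'n \<Rightarrow> complex ^ 'n \<Rightarrow> complex)"
    unfolding bilinear_def
    by (auto intro!: linearI simp: herm_def sum.distrib sum_distrib_left scaleR_sum_right algebra_simps)
qed

lemmas has_vector_derivative_herm = bounded_bilinear.has_vector_derivative[OF bounded_bilinear_herm]

text \<open>The Schwarzian derivative of a holomorphic curve in terms of its first three complex derivatives.\<close>

definition curve_schwarzian :: "complex ^ 'n \<Rightarrow> complex ^ 'n \<Rightarrow> complex ^ 'n \<Rightarrow> complex" where
  "curve_schwarzian a b c = herm c a / of_real (inner a a) - 3 / 2 * (herm b a / of_real (inner a a))\<^sup>2"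

text \<open>Three quarters of \<open>\<bar>\<phi>'\<bar>\<^sup>2 \<bar>K\<bar>\<close>, in terms of the first two complex derivatives of \<open>\<phi>\<close>.\<close>

definition curve_bending :: "complex ^ 'n \<Rightarrow> complex ^ 'n \<Rightarrow> real" where
  "curve_bending a b = 3 / 2 * (inner b b / inner a a - (cmod (herm b a))\<^sup>2 / (inner a a)\<^sup>2)"

text \<open>The arguments on the left are the derivatives of \<open>\<phi> \<circ> T\<close> along a curve \<open>T\<close> with \<open>T' = t\<close>,
  \<open>T'' = t \<tau>\<close> and \<open>T''' = 3/2 t \<tau>\<^sup>2\<close>; the last relation says that \<open>T\<close> has vanishing Schwarzian, which is
  why all terms with \<open>\<tau>\<close> cancel. For a complex curve the normal curvature in every direction is the
  same, and it is determined by \<open>K\<close>; this is where the constant \<open>3/4\<close> comes from.\<close>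

lemma ahlfors_schwarzian_moebius_parameter:
  fixes a b c :: "complex ^ 'n" and t \<tau> :: complex
  assumes a: "a \<noteq> 0" and t: "t \<noteq> 0"
  shows "ahlfors_schwarzian (t *s a) (t\<^sup>2 *s b + (t * \<tau>) *s a)
           (t ^ 3 *s c + (3 * t\<^sup>2 * \<tau>) *s b + (3 / 2 * t * \<tau>\<^sup>2) *s a)
       = Re (t\<^sup>2 * curve_schwarzian a b c) + (cmod t)\<^sup>2 * curve_bending a b"
proof -
  let ?a = "t *s a" and ?b = "t\<^sup>2 *s b + (t * \<tau>) *s a"
    and ?c = "t ^ 3 *s c + (3 * t\<^sup>2 * \<tau>) *s b + (3 / 2 * t * \<tau>\<^sup>2) *s a"
  define N where "N = inner a a"
  have N: "N \<noteq> 0" using a by (simp add: N_def)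
  define M where "M = (cmod t)\<^sup>2 * N"
  have M: "M \<noteq> 0" using N t by (simp add: M_def)
  have M': "complex_of_real M = t * cnj t * of_real N"
    by (simp only: M_def of_real_mult complex_norm_square)
  define \<alpha> where "\<alpha> = herm b a / of_real N"
  define \<beta> where "\<beta> = herm c a / of_real N"
  define \<epsilon> where "\<epsilon> = inner b b / N"
  have h: "herm a a = of_real N" "herm b a = of_real N * \<alpha>" "herm c a = of_real N * \<beta>"
    "herm b b = of_real N * of_real \<epsilon>" "herm a b = of_real N * cnj \<alpha>"
    using N by (simp_all add: herm_self N_def[symmetric] \<alpha>_def \<beta>_def \<epsilon>_def herm_commute)
  have inner_eq: "inner v w = M * Re z" if "herm w v = of_real M * z" for v w :: "complex ^ 'n" and z
    using Re_herm[of w v] that by (simp add: inner_commute)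
  have "herm ?a ?a = of_real M * 1"
    by (simp add: h M')
  then have i1: "inner ?a ?a = M"
    using inner_eq by fastforce
  have "herm ?b ?a = of_real M * (t * \<alpha> + \<tau>)"
    by (simp add: h M' power2_eq_square algebra_simps)
  then have i2: "inner ?a ?b = M * Re (t * \<alpha> + \<tau>)"
    by (rule inner_eq)
  have "herm ?c ?a = of_real M * (t\<^sup>2 * \<beta> + 3 * \<tau> * (t * \<alpha>) + 3 / 2 * \<tau>\<^sup>2)"
    by (simp add: h M' power2_eq_square power3_eq_cube algebra_simps)
  then have i3: "inner ?a ?c = M * Re (t\<^sup>2 * \<beta> + 3 * \<tau> * (t * \<alpha>) + 3 / 2 * \<tau>\<^sup>2)"
    by (rule inner_eq)
  have "herm ?b ?b = of_real M * (t * cnj t * of_real \<epsilon> + (t * \<alpha>) * cnj \<tau> + cnj (t * \<alpha>) * \<tau> + \<tau> * cnj \<tau>)"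
    by (simp add: h M' power2_eq_square algebra_simps)
  then have i4: "inner ?b ?b = M * Re (t * cnj t * of_real \<epsilon> + (t * \<alpha>) * cnj \<tau> + cnj (t * \<alpha>) * \<tau> + \<tau> * cnj \<tau>)"
    by (rule inner_eq)
  have "ahlfors_schwarzian ?a ?b ?c =
      Re (t\<^sup>2 * \<beta> + 3 * \<tau> * (t * \<alpha>) + 3 / 2 * \<tau>\<^sup>2) - 3 * (Re (t * \<alpha> + \<tau>))\<^sup>2
      + 3 / 2 * Re (t * cnj t * of_real \<epsilon> + (t * \<alpha>) * cnj \<tau> + cnj (t * \<alpha>) * \<tau> + \<tau> * cnj \<tau>)"
    unfolding ahlfors_schwarzian_def i1 i2 i3 i4 using M by (simp add: power_mult_distrib)
  also have "\<dots> = Re (t\<^sup>2 * \<beta> - 3 / 2 * (t * \<alpha>)\<^sup>2) + 3 / 2 * ((cmod t)\<^sup>2 * \<epsilon> - (cmod (t * \<alpha>))\<^sup>2)"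
  proof -
    define z where "z = t * \<alpha>"
    have t: "Re (t * cnj t * of_real \<epsilon>) = (cmod t)\<^sup>2 * \<epsilon>"
      by (simp only: complex_norm_square[symmetric] of_real_mult[symmetric] Re_complex_of_real)
    have z: "(cmod z)\<^sup>2 = Re z * Re z + Im z * Im z"
      by (simp add: cmod_power2 flip: power2_eq_square)
    show ?thesis
      unfolding z_def[symmetric] plus_complex.sel t z by (simp add: power2_eq_square field_simps)
  qed
  also have "\<dots> = Re (t\<^sup>2 * curve_schwarzian a b c) + (cmod t)\<^sup>2 * curve_bending a b"
  proof -
    have "curve_schwarzian a b c = \<beta> - 3 / 2 * \<alpha>\<^sup>2"
      by (simp add: curve_schwarzian_def \<alpha>_def \<beta>_def N_def)
    moreover have "curve_bending a b = 3 / 2 * (\<epsilon> - (cmod \<alpha>)\<^sup>2)"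
      by (simp add: curve_bending_def \<alpha>_def \<epsilon>_def N_def norm_divide power_divide)
    ultimately show ?thesis
      by (simp only: right_diff_distrib norm_mult power_mult_distrib mult_ac)
  qed
  finally show ?thesis .
qed

lemma curve_holomorphic_deriv:
  assumes "curve_holomorphic_on \<phi> S" "open S"
  shows "curve_holomorphic_on (curve_deriv \<phi>) S"
  using assms by (simp add: curve_holomorphic_on_def curve_deriv_def holomorphic_deriv)

lemma curve_holomorphic_chain:
  fixes \<phi> :: "complex \<Rightarrow> complex ^ 'n"
  assumes hol: "curve_holomorphic_on \<phi> S" "open S" "T x \<in> S"
    and T: "(T has_vector_derivative T') (at x)"
  shows "((\<lambda>x. \<phi> (T x)) has_vector_derivative T' *s curve_deriv \<phi> (T x)) (at x)"
proof -
  have "((\<lambda>x. \<phi> (T x) $ k) has_vector_derivative (T' *s curve_deriv \<phi> (T x)) $ k) (at x)" for k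
  proof -
    have "((\<lambda>w. \<phi> w $ k) has_field_derivative curve_deriv \<phi> (T x) $ k) (at (T x))"
      using hol by (auto simp: curve_holomorphic_on_def curve_deriv_def intro: holomorphic_derivI)
    from field_vector_diff_chain_at[OF T this] show ?thesis by (simp add: o_def)
  qed
  then have comp: "((\<lambda>x. \<phi> (T x) $ k) has_derivative (\<lambda>h. (h *\<^sub>R (T' *s curve_deriv \<phi> (T x))) $ k)) (at x)" for k
    by (simp add: has_vector_derivative_def)
  show ?thesis
    unfolding has_vector_derivative_def has_derivative_componentwise_within[of "\<lambda>x. \<phi> (T x)"]
  proof
    fix i :: "complex ^ 'n" assume "i \<in> Basis"
    then obtain k b where i: "i = axis k b" by (auto simp: Basis_vec_def)
    show "((\<lambda>x. inner (\<phi> (T x)) i) has_derivative (\<lambda>h. inner (h *\<^sub>R (T' *s curve_deriv \<phi> (T x))) i)) (at x)"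
      unfolding i inner_axis by (rule bounded_linear.has_derivative[OF bounded_linear_inner_left comp])
  qed
qed

lemma line_has_vector_derivative:
  "((\<lambda>t. z + e * complex_of_real t) has_vector_derivative e) (at t)"
  by (auto intro!: derivative_eq_intros)

text \<open>Lets an inner partial derivative be replaced by a formula for it that holds only on an open set.\<close>

lemma line_derivative_cong:
  assumes S: "open S" "z \<in> S" and eq: "\<And>w. w \<in> S \<Longrightarrow> f w = g w"
    and g: "((\<lambda>t. g (z + e * complex_of_real t)) has_vector_derivative d) (at 0)"
  shows "((\<lambda>t. f (z + e * complex_of_real t)) has_vector_derivative d) (at 0)"
proof -
  let ?S = "(\<lambda>t. z + e * complex_of_real t) -` S"
  have "open ?S"
    using S(1) by (rule open_vimage) (intro continuous_intros)
  then show ?thesis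
    by (rule has_vector_derivative_transform_within_open[OF g]) (use S eq in auto)
qed

lemma partial_xI:
  assumes "((\<lambda>t. f (z + 1 * complex_of_real t)) has_vector_derivative d) (at 0)"
  shows "partial_x f z = d"
  using vector_derivative_at[OF assms] by (simp add: partial_x_def)

lemma partial_yI:
  assumes "((\<lambda>t. f (z + \<i> * complex_of_real t)) has_vector_derivative d) (at 0)"
  shows "partial_y f z = d"
  using vector_derivative_at[OF assms] by (simp add: partial_y_def)

lemma log_speed_eq: "log_speed \<phi> z = ln (inner (curve_deriv \<phi> z) (curve_deriv \<phi> z)) / 2"
  by (simp add: log_speed_def inner_vec_def curve_deriv_def flip: power2_norm_eq_inner)

text \<open>Along a horizontal or vertical line every derivative is a Hermitian product of derivatives of \<open>\<phi>\<close>, up to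
  a factor \<open>1\<close>, \<open>\<i>\<close> or its conjugate. Combining the two directions, \<open>wirtinger\<close> keeps the part that is linear in
  this factor and the Laplacian keeps the mixed part.\<close>

lemma criterion_lhs_eq:
  fixes \<phi> :: "complex \<Rightarrow> complex ^ 'n"
  assumes hol: "curve_holomorphic_on \<phi> S" and S: "open S" and imm: "\<And>z. z \<in> S \<Longrightarrow> curve_deriv \<phi> z \<noteq> 0"
    and z: "z \<in> S"
  defines "d1 \<equiv> curve_deriv \<phi>" and "d2 \<equiv> curve_deriv (curve_deriv \<phi>)"
    and "d3 \<equiv> curve_deriv (curve_deriv (curve_deriv \<phi>))"
  shows "criterion_lhs \<phi> z = cmod (curve_schwarzian (d1 z) (d2 z) (d3 z)) + \<bar>curve_bending (d1 z) (d2 z)\<bar>"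
proof -
  have hol1: "curve_holomorphic_on d1 S" unfolding d1_def by (rule curve_holomorphic_deriv[OF hol S])
  have hol2: "curve_holomorphic_on d2 S" unfolding d2_def d1_def[symmetric] by (rule curve_holomorphic_deriv[OF hol1 S])
  define N where "N w = inner (d1 w) (d1 w)" for w
  define A where "A w = herm (d2 w) (d1 w)" for w
  define B where "B w = herm (d3 w) (d1 w)" for w
  define E where "E w = inner (d2 w) (d2 w)" for w
  have N: "0 < N w" if "w \<in> S" for w using imm[OF that] by (simp add: N_def d1_def)
  note line = line_has_vector_derivative
  have D1: "((\<lambda>t. d1 (w + e * of_real t)) has_vector_derivative e *s d2 w) (at 0)"
    and D2: "((\<lambda>t. d2 (w + e * of_real t)) has_vector_derivative e *s d3 w) (at 0)" if w: "w \<in> S" for w e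
    using curve_holomorphic_chain[OF hol1 S, of "\<lambda>t. w + e * of_real t" 0, OF _ line]
      curve_holomorphic_chain[OF hol2 S, of "\<lambda>t. w + e * of_real t" 0, OF _ line] w
    by (simp_all add: d1_def d2_def d3_def)
  have DN: "((\<lambda>t. N (w + e * of_real t)) has_real_derivative 2 * Re (e * A w)) (at 0)" if w: "w \<in> S" for w e
  proof -
    have "Re (e * A w) = inner (d1 w) (e *s d2 w)"
      using Re_herm[of "e *s d2 w" "d1 w"] by (simp add: A_def inner_commute)
    then show ?thesis
      using has_real_derivative_inner[OF D1[OF w, of e] D1[OF w, of e]] by (simp add: N_def inner_commute)
  qed
  have DA: "((\<lambda>t. A (w + e * of_real t)) has_vector_derivative e * B w + cnj e * of_real (E w)) (at 0)"
    if w: "w \<in> S" for w e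
    using has_vector_derivative_herm[OF D2[OF w, of e] D1[OF w, of e]]
    by (simp add: A_def B_def E_def herm_self add.commute)
  let ?\<sigma> = "log_speed \<phi>"
  have \<sigma>: "?\<sigma> w = ln (N w) / 2" for w by (simp add: log_speed_eq N_def d1_def)
  have D\<sigma>: "((\<lambda>t. ?\<sigma> (w + e * of_real t)) has_real_derivative Re (e * A w) / N w) (at 0)" if w: "w \<in> S" for w e
  proof -
    have "((\<lambda>t. ln (N (w + e * of_real t)) / 2) has_real_derivative
        inverse (N (w + e * of_real 0)) * (2 * Re (e * A w)) / 2) (at 0)"
      by (intro DERIV_cdivide DERIV_chain2[OF DERIV_ln DN[OF w]]) (use N[OF w] in simp)
    moreover have "inverse (N (w + e * of_real 0)) * (2 * Re (e * A w)) / 2 = Re (e * A w) / N w"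
      by (simp only: of_real_0 mult_zero_right add_0_right divide_inverse) algebra
    ultimately show ?thesis by (simp only: \<sigma>)
  qed
  have \<sigma>x: "partial_x ?\<sigma> w = Re (A w) / N w" and \<sigma>y: "partial_y ?\<sigma> w = - Im (A w) / N w" if w: "w \<in> S" for w
    using D\<sigma>[OF w, of 1] D\<sigma>[OF w, of \<i>]
    by (auto intro!: partial_xI partial_yI simp: has_real_derivative_iff_has_vector_derivative)
  let ?s = "\<lambda>w. complex_of_real (?\<sigma> w)"
  have W: "wirtinger ?s w = (1 / (2 * N w)) *\<^sub>R A w" if w: "w \<in> S" for w
  proof -
    have "((\<lambda>t. ?s (w + e * of_real t)) has_vector_derivative of_real (Re (e * A w) / N w)) (at 0)" for e
      using has_vector_derivative_of_real D\<sigma>[OF w, of e]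
      unfolding has_real_derivative_iff_has_vector_derivative by blast
    from partial_xI[OF this] partial_yI[OF this] show ?thesis
      by (simp add: wirtinger_def complex_eq_iff)
  qed
  have DW: "((\<lambda>t. wirtinger ?s (z + e * of_real t)) has_vector_derivative
      (1 / (2 * N z)) *\<^sub>R (e * B z + cnj e * of_real (E z)) + (- (Re (e * A z) / (N z)\<^sup>2)) *\<^sub>R A z) (at 0)" for e
  proof (rule line_derivative_cong[OF S z W])
    define r where "r = Re (e * A z)"
    have "((\<lambda>t. inverse (2 * N (z + e * of_real t))) has_real_derivative
        - (2 * (2 * r) * inverse ((2 * N (z + e * of_real 0)) ^ Suc (Suc 0)))) (at 0)"
      unfolding r_def by (intro DERIV_inverse_fun DERIV_cmult DN z) (use N[OF z] in simp)
    moreover have "- (2 * (2 * r) * inverse ((2 * N (z + e * of_real 0)) ^ Suc (Suc 0))) = - (r / (N z)\<^sup>2)"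
      using N[OF z] by (simp add: field_simps power2_eq_square)
    ultimately have "((\<lambda>t. 1 / (2 * N (z + e * of_real t))) has_real_derivative - (Re (e * A z) / (N z)\<^sup>2)) (at 0)"
      by (simp only: r_def inverse_eq_divide)
    from has_vector_derivative_scaleR[OF this DA[OF z, of e]]
    show "((\<lambda>t. (1 / (2 * N (z + e * of_real t))) *\<^sub>R A (z + e * of_real t)) has_vector_derivative
      (1 / (2 * N z)) *\<^sub>R (e * B z + cnj e * of_real (E z)) + (- (Re (e * A z) / (N z)\<^sup>2)) *\<^sub>R A z) (at 0)"
      by simp
  qed
  have "wirtinger (wirtinger ?s) z = B z / of_real (2 * N z) - (A z)\<^sup>2 / of_real (2 * (N z)\<^sup>2)"
    using N[OF z] unfolding wirtinger_def[of "wirtinger ?s"] partial_xI[OF DW[of 1]] partial_yI[OF DW[of \<i>]]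
    by (simp add: complex_eq_iff field_simps power2_eq_square)
  moreover have "(1 / (2 * N z)) *\<^sub>R A z = A z / (2 * of_real (N z))"
    by (simp add: scaleR_conv_of_real)
  moreover have "2 * (b / of_real (2 * N z) - a\<^sup>2 / of_real (2 * (N z)\<^sup>2) - (a / (2 * of_real (N z)))\<^sup>2)
      = b / of_real (N z) - 3 / 2 * (a / of_real (N z))\<^sup>2" for a b :: complex
    using N[OF z] by (simp add: field_simps power2_eq_square)
  ultimately have schw: "schwarzian \<phi> z = curve_schwarzian (d1 z) (d2 z) (d3 z)"
    unfolding schwarzian_def Let_def curve_schwarzian_def N_def[symmetric] A_def[symmetric] B_def[symmetric]
    by (simp only: W[OF z])
  have Dquot: "((\<lambda>t. Re (c * A (z + e * of_real t)) / N (z + e * of_real t)) has_vector_derivative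
      (Re (c * (e * B z + cnj e * of_real (E z))) * N z - Re (c * A z) * (2 * Re (e * A z))) / (N z * N z)) (at 0)" for c e
  proof -
    have "((\<lambda>t. Re (c * A (z + e * of_real t))) has_real_derivative Re (c * (e * B z + cnj e * of_real (E z)))) (at 0)"
      unfolding has_real_derivative_iff_has_vector_derivative
      by (intro bounded_linear.has_vector_derivative[OF bounded_linear_Re] has_vector_derivative_mult_right DA z)
    from DERIV_divide[OF this DN[OF z, of e]] show ?thesis
      using N[OF z] by (simp add: has_real_derivative_iff_has_vector_derivative)
  qed
  have "partial_x (partial_x ?\<sigma>) z = ((Re (B z) + E z) * N z - Re (A z) * (2 * Re (A z))) / (N z * N z)"
    by (rule partial_xI, rule line_derivative_cong[OF S z, where g = "\<lambda>w. Re (1 * A w) / N w"])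
       (use \<sigma>x Dquot[of 1 1] in simp_all)
  moreover have "partial_y (partial_y ?\<sigma>) z = ((E z - Re (B z)) * N z - Im (A z) * (2 * Im (A z))) / (N z * N z)"
    by (rule partial_yI, rule line_derivative_cong[OF S z, where g = "\<lambda>w. Re (\<i> * A w) / N w"])
       (use \<sigma>y Dquot[of \<i> \<i>] in simp_all)
  ultimately have lap: "laplacian ?\<sigma> z = 2 * (E z / N z - (cmod (A z))\<^sup>2 / (N z)\<^sup>2)"
    using N[OF z] unfolding laplacian_def cmod_power2 by (simp add: field_simps power2_eq_square)
  have "exp (- 2 * ?\<sigma> z) = 1 / N z"
    using N[OF z] by (simp add: \<sigma> exp_minus inverse_eq_divide)
  moreover have "(norm (d1 z))\<^sup>2 = N z" by (simp add: N_def power2_norm_eq_inner)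
  moreover have "3 / 4 * n * \<bar>- (1 / n) * (2 * x)\<bar> = \<bar>3 / 2 * x\<bar>" if "0 < n" for n x :: real
    using that by (simp add: abs_mult)
  ultimately have "3 / 4 * (norm (curve_deriv \<phi> z))\<^sup>2 * \<bar>curvature \<phi> z\<bar> = \<bar>curve_bending (d1 z) (d2 z)\<bar>"
    using N[OF z] unfolding curvature_def lap curve_bending_def N_def[symmetric] A_def[symmetric] E_def[symmetric]
      d1_def[symmetric]
    by (simp only: )
  then show ?thesis by (simp add: criterion_lhs_def schw)
qed

section \<open>Geodesics of the hyperbolic disk\<close>

text \<open>The image of the imaginary axis under the automorphism \<open>z \<mapsto> (c + z) / (1 + c z)\<close> of the disk, rotated
  by \<open>\<omega>\<close>. The value at \<open>0\<close> is its point nearest to the origin.\<close>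

definition geodesic :: "real \<Rightarrow> complex \<Rightarrow> real \<Rightarrow> complex" where
  "geodesic c \<omega> x = \<omega> * (of_real c + \<i> * of_real x) / (1 + \<i> * of_real c * of_real x)"

definition geodesic_velocity :: "real \<Rightarrow> complex \<Rightarrow> real \<Rightarrow> complex" where
  "geodesic_velocity c \<omega> x = \<omega> * \<i> * of_real (1 - c\<^sup>2) / (1 + \<i> * of_real c * of_real x)\<^sup>2"

definition geodesic_log_acceleration :: "real \<Rightarrow> real \<Rightarrow> complex" where
  "geodesic_log_acceleration c x = - 2 * \<i> * of_real c / (1 + \<i> * of_real c * of_real x)"

lemma geodesic_denominator: "1 + \<i> * of_real c * of_real x \<noteq> 0"
  by (simp add: complex_eq_iff)

text \<open>The third equation states that the Schwarzian derivative of the parametrization vanishes.\<close>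

lemma geodesic_has_derivatives:
  "(geodesic c \<omega> has_vector_derivative geodesic_velocity c \<omega> x) (at x)"
  "(geodesic_velocity c \<omega> has_vector_derivative geodesic_velocity c \<omega> x * geodesic_log_acceleration c x) (at x)"
  "((\<lambda>x. geodesic_velocity c \<omega> x * geodesic_log_acceleration c x) has_vector_derivative
      3 / 2 * geodesic_velocity c \<omega> x * (geodesic_log_acceleration c x)\<^sup>2) (at x)"
proof -
  let ?n = "\<lambda>z. 1 + \<i> * of_real c * z"
  let ?x = "complex_of_real x"
  have nz: "?n ?x \<noteq> 0" by (rule geodesic_denominator)
  have lin: "((\<lambda>z. a + b * z) has_field_derivative b) (at z)" for a b z :: complex
    by (auto intro!: derivative_eq_intros)
  have inv: "((\<lambda>z. k / ?n z ^ m) has_field_derivative - (of_nat m * \<i> * of_real c * k / ?n ?x ^ Suc m)) (at ?x)"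
    for k and m :: nat
  proof -
    have "((\<lambda>z. k * inverse (?n z ^ m)) has_field_derivative
        k * - (of_nat m * ((\<i> * of_real c) * ?n ?x ^ (m - Suc 0)) * inverse ((?n ?x ^ m) ^ Suc (Suc 0)))) (at ?x)"
      by (intro DERIV_cmult DERIV_inverse_fun DERIV_power lin) (use nz in simp)
    moreover have "k * - (of_nat m * ((\<i> * of_real c) * ?n ?x ^ (m - Suc 0)) * inverse ((?n ?x ^ m) ^ Suc (Suc 0)))
        = - (of_nat m * \<i> * of_real c * k / ?n ?x ^ Suc m)"
    proof -
      have "k * - (of_nat m * (d * n ^ (m - Suc 0)) * inverse ((n ^ m) ^ Suc (Suc 0))) = - (of_nat m * d * k / n ^ Suc m)"
        if "n \<noteq> 0" for n d :: complex
        using that by (cases m) (simp_all add: field_simps)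
      from this[OF nz, of "\<i> * of_real c"] show ?thesis by (simp only: mult.assoc)
    qed
    ultimately show ?thesis by (simp only: divide_inverse)
  qed
  have "((\<lambda>z. \<omega> * (of_real c + \<i> * z) / ?n z) has_field_derivative
      ((\<omega> * \<i>) * ?n ?x - \<omega> * (of_real c + \<i> * ?x) * (\<i> * of_real c)) / (?n ?x * ?n ?x)) (at ?x)"
    by (intro DERIV_divide DERIV_cmult lin nz)
  moreover have "((\<omega> * \<i>) * ?n ?x - \<omega> * (of_real c + \<i> * ?x) * (\<i> * of_real c)) / (?n ?x * ?n ?x)
      = geodesic_velocity c \<omega> x"
    by (simp add: geodesic_velocity_def power2_eq_square algebra_simps)
  ultimately show "(geodesic c \<omega> has_vector_derivative geodesic_velocity c \<omega> x) (at x)"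
    unfolding geodesic_def[abs_def] by (intro has_vector_derivative_real_field) simp
  show "(geodesic_velocity c \<omega> has_vector_derivative geodesic_velocity c \<omega> x * geodesic_log_acceleration c x) (at x)"
  proof -
    have "- (of_nat 2 * \<i> * of_real c * (\<omega> * \<i> * of_real (1 - c\<^sup>2)) / ?n ?x ^ Suc 2) =
        geodesic_velocity c \<omega> x * geodesic_log_acceleration c x"
      by (simp add: geodesic_velocity_def geodesic_log_acceleration_def power2_eq_square eval_nat_numeral mult_ac)
    with inv[of "\<omega> * \<i> * of_real (1 - c\<^sup>2)" 2] show ?thesis
      unfolding geodesic_velocity_def[abs_def] by (intro has_vector_derivative_real_field) (simp only:)
  qed
  show "((\<lambda>x. geodesic_velocity c \<omega> x * geodesic_log_acceleration c x) has_vector_derivative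
      3 / 2 * geodesic_velocity c \<omega> x * (geodesic_log_acceleration c x)\<^sup>2) (at x)"
  proof -
    let ?k = "\<omega> * \<i> * of_real (1 - c\<^sup>2) * (- 2 * \<i> * of_real c)"
    have "- (of_nat 3 * \<i> * of_real c * ?k / ?n ?x ^ Suc 3) =
        3 / 2 * geodesic_velocity c \<omega> x * (geodesic_log_acceleration c x)\<^sup>2"
    proof -
      have "- (of_nat 3 * d * (a * (- 2 * d)) / n ^ Suc 3) = 3 / 2 * (a / n\<^sup>2) * (- 2 * d / n)\<^sup>2"
        for d a n :: complex
        by (cases "n = 0") (simp_all add: field_simps power2_eq_square eval_nat_numeral)
      from this[of "\<i> * of_real c" "\<omega> * \<i> * of_real (1 - c\<^sup>2)" "?n ?x"] show ?thesis
        unfolding geodesic_velocity_def geodesic_log_acceleration_def by (simp only: mult.assoc)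
    qed
    moreover have "(\<lambda>x. geodesic_velocity c \<omega> x * geodesic_log_acceleration c x) =
        (\<lambda>x. ?k / ?n (of_real x) ^ 3)"
      by (simp add: geodesic_velocity_def geodesic_log_acceleration_def power2_eq_square power3_eq_cube mult_ac)
    ultimately show ?thesis
      using has_vector_derivative_real_field[OF inv[of ?k 3]] by (simp only:)
  qed
qed

lemma norm_geodesic:
  assumes "cmod \<omega> = 1"
  shows "(cmod (geodesic c \<omega> x))\<^sup>2 = (c\<^sup>2 + x\<^sup>2) / (1 + c\<^sup>2 * x\<^sup>2)"
proof -
  have "(cmod (of_real c + \<i> * of_real x))\<^sup>2 = c\<^sup>2 + x\<^sup>2"
    "(cmod (1 + \<i> * of_real c * of_real x))\<^sup>2 = 1 + c\<^sup>2 * x\<^sup>2"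
    by (simp_all add: cmod_power2 power_mult_distrib)
  then show ?thesis
    by (simp add: geodesic_def norm_divide norm_mult power_divide assms)
qed

lemma one_minus_norm_geodesic:
  assumes "cmod \<omega> = 1"
  shows "1 - (cmod (geodesic c \<omega> x))\<^sup>2 = (1 - c\<^sup>2) * (1 - x\<^sup>2) / (1 + c\<^sup>2 * x\<^sup>2)"
proof -
  have "0 < 1 + c\<^sup>2 * x\<^sup>2" by (simp add: add_pos_nonneg)
  then show ?thesis unfolding norm_geodesic[OF assms] by (simp add: field_simps)
qed

lemma norm_geodesic_velocity:
  assumes "cmod \<omega> = 1" "\<bar>c\<bar> < 1"
  shows "cmod (geodesic_velocity c \<omega> x) = (1 - c\<^sup>2) / (1 + c\<^sup>2 * x\<^sup>2)"
proof -
  have "c\<^sup>2 < 1" using assms(2) by (simp add: abs_square_less_1)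
  moreover have "cmod (1 + \<i> * of_real c * of_real x) ^ 2 = 1 + c\<^sup>2 * x\<^sup>2"
    by (simp add: cmod_power2 power_mult_distrib)
  ultimately show ?thesis
    unfolding geodesic_velocity_def norm_divide norm_mult norm_power by (simp add: assms del: of_real_diff)
qed

lemma geodesic_in_disc:
  assumes "cmod \<omega> = 1" "\<bar>c\<bar> < 1" "\<bar>x\<bar> < 1"
  shows "cmod (geodesic c \<omega> x) < 1"
proof -
  have "0 < (1 - c\<^sup>2) * (1 - x\<^sup>2) / (1 + c\<^sup>2 * x\<^sup>2)"
    using assms by (intro divide_pos_pos mult_pos_pos add_pos_nonneg) (auto simp: abs_square_less_1)
  then show ?thesis
    unfolding one_minus_norm_geodesic[OF assms(1), symmetric] by (simp add: abs_square_less_1)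
qed

text \<open>With the nearest point at parameter \<open>0\<close>, a point of the geodesic is no closer to the origin than the
  corresponding point of the diameter. This is what the monotonicity of \<open>(1 - x\<^sup>2)\<^sup>2 p x\<close> is used with.\<close>

lemma geodesic_farther:
  assumes "cmod \<omega> = 1" "\<bar>x\<bar> < 1"
  shows "\<bar>x\<bar> \<le> cmod (geodesic c \<omega> x)"
proof -
  have "x\<^sup>2 * (1 + c\<^sup>2 * x\<^sup>2) \<le> c\<^sup>2 + x\<^sup>2"
  proof -
    have "x\<^sup>2 * x\<^sup>2 \<le> 1 * 1"
      using assms(2) by (intro mult_mono) (auto simp: abs_square_le_1)
    then have "c\<^sup>2 * (x\<^sup>2 * x\<^sup>2) \<le> c\<^sup>2 * 1" by (intro mult_left_mono) auto
    then show ?thesis by (simp add: algebra_simps)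
  qed
  then have "\<bar>x\<bar>\<^sup>2 \<le> (cmod (geodesic c \<omega> x))\<^sup>2"
    unfolding norm_geodesic[OF assms(1)] by (simp add: pos_le_divide_eq add_pos_nonneg)
  then show ?thesis by (rule power2_le_imp_le) simp
qed

lemma geodesic_reverse: "geodesic (- c) (- \<omega>) (- x) = geodesic c \<omega> x"
proof -
  have "(- \<omega>) * (of_real (- c) + \<i> * of_real (- x)) = \<omega> * (of_real c + \<i> * of_real x)"
    by (simp add: algebra_simps)
  then show ?thesis by (simp add: geodesic_def)
qed

text \<open>The equation is that of the circle or line orthogonal to the unit circle on which the geodesic lies.\<close>

lemma geodesic_hits:
  assumes \<omega>: "cmod \<omega> = 1" and c: "\<bar>c\<bar> < 1" and z: "cmod z \<le> 1"
    and eq: "(1 + c\<^sup>2) * Re (z * cnj \<omega>) = c * ((cmod z)\<^sup>2 + 1)"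
  obtains x where "\<bar>x\<bar> \<le> 1" "geodesic c \<omega> x = z"
proof -
  define y where "y = z * cnj \<omega>"
  have \<omega>\<omega>: "\<omega> * cnj \<omega> = 1" using complex_norm_square[of \<omega>] \<omega> by simp
  have zy: "z = \<omega> * y" using \<omega>\<omega> by (simp add: y_def mult_ac)
  have ny: "cmod y = cmod z" by (simp add: y_def norm_mult \<omega>)
  define d where "d = 1 - of_real c * y"
  have d: "d \<noteq> 0"
  proof
    assume "d = 0"
    then have "cmod (of_real c * y) = 1" by (simp add: d_def)
    moreover have "\<bar>c\<bar> * cmod y \<le> \<bar>c\<bar> * 1" using z ny by (intro mult_left_mono) auto
    ultimately show False using c by (simp add: norm_mult)
  qed
  \<comment> \<open>Solve \<open>y = (c + u) / (1 + c u)\<close> for \<open>u\<close>; the hypothesis says that the solution is purely imaginary.\<close>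
  define u where "u = (y - of_real c) / d"
  have "Re ((y - of_real c) * cnj d) = (1 + c\<^sup>2) * Re y - c * ((cmod y)\<^sup>2 + 1)"
    unfolding cmod_power2 by (simp add: d_def power2_eq_square algebra_simps)
  also have "\<dots> = 0" using eq by (simp add: y_def norm_mult \<omega>)
  finally have "Re u = 0" by (simp add: u_def Re_divide' )
  then have u: "u = \<i> * of_real (Im u)" by (simp add: complex_eq_iff)
  have ud: "u * d = y - of_real c" using d by (simp add: u_def)
  have "1 - c\<^sup>2 \<noteq> 0" using c abs_square_eq_1[of c] by auto
  have "of_real c + u = (1 + of_real c * u) * y"
    using ud by (simp add: d_def algebra_simps)
  moreover have "1 + of_real c * u \<noteq> 0"
    using geodesic_denominator[of c "Im u"] by (subst u) (simp add: mult_ac)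
  ultimately have "\<omega> * (of_real c + u) / (1 + of_real c * u) = z"
    by (simp add: zy)
  then have g: "geodesic c \<omega> (Im u) = z"
    unfolding geodesic_def using u by (metis mult.assoc mult.commute)
  have "0 \<le> 1 - (cmod z)\<^sup>2" using z by (simp add: abs_square_le_1)
  then have "0 \<le> (1 - c\<^sup>2) * (1 - (Im u)\<^sup>2) / (1 + c\<^sup>2 * (Im u)\<^sup>2)"
    unfolding one_minus_norm_geodesic[OF \<omega>, symmetric] g .
  moreover have "0 < 1 - c\<^sup>2" "0 < 1 + c\<^sup>2 * (Im u)\<^sup>2"
    using c by (auto simp: abs_square_less_1 add_pos_nonneg)
  ultimately have "(Im u)\<^sup>2 \<le> 1"
    by (simp add: zero_le_divide_iff zero_le_mult_iff)
  then have "\<bar>Im u\<bar> \<le> 1" by (simp add: abs_square_le_1)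
  then show ?thesis using g by (rule that)
qed

text \<open>Both points satisfy a common circle equation, by linear algebra; the strict inequality \<open>\<bar>c\<bar> < 1\<close> comes
  from their being distinct.\<close>

lemma geodesic_through:
  assumes z: "cmod z1 \<le> 1" "cmod z2 \<le> 1" and ne: "z1 \<noteq> z2"
  obtains c \<omega> x1 x2 where "\<bar>c\<bar> < 1" "cmod \<omega> = 1" "-1 \<le> x1" "x1 < x2" "x2 \<le> 1"
    "geodesic c \<omega> x1 = z1" "geodesic c \<omega> x2 = z2"
proof -
  define s where "s z = (cmod z)\<^sup>2 + 1" for z
  have s: "0 < s z" for z by (simp add: s_def add_nonneg_pos)
  \<comment> \<open>The geodesics are the sets \<open>2 Re (z cnj \<omega>) = l (\<bar>z\<bar>\<^sup>2 + 1)\<close> with \<open>\<bar>l\<bar> < 1\<close>; eliminating \<open>l\<close> from the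
    equations for \<open>z1\<close> and \<open>z2\<close> says that \<open>\<omega>\<close> is orthogonal to \<open>v\<close>.\<close>
  define v where "v = of_real (s z2) * z1 - of_real (s z1) * z2"
  have v: "v \<noteq> 0"
  proof
    assume "v = 0"
    then have eq: "of_real (s z2) * z1 = of_real (s z1) * z2" by (simp add: v_def)
    then have "cmod (of_real (s z2) * z1) = cmod (of_real (s z1) * z2)" by simp
    then have "s z2 * cmod z1 = s z1 * cmod z2" using s[of z1] s[of z2] by (simp add: norm_mult)
    then have "(cmod z1 - cmod z2) * (1 - cmod z1 * cmod z2) = 0"
      by (simp add: s_def power2_eq_square algebra_simps)
    moreover have "cmod z1 = cmod z2" if "cmod z1 * cmod z2 = 1"
    proof -
      have "cmod z1 * cmod z2 \<le> cmod z1" "cmod z1 * cmod z2 \<le> cmod z2"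
        using z by (simp_all add: mult_left_le mult_left_le_one_le)
      then show ?thesis using z that by simp
    qed
    ultimately have "cmod z1 = cmod z2" by auto
    then have "s z1 = s z2" by (simp add: s_def)
    then show False using eq ne s[of z2] by simp
  qed
  define \<omega> where "\<omega> = \<i> * sgn v"
  have \<omega>: "cmod \<omega> = 1" using v by (simp add: \<omega>_def norm_mult norm_sgn)
  have orth: "Re (v * cnj \<omega>) = 0"
    by (simp add: \<omega>_def sgn_div_norm algebra_simps)
  define l where "l = 2 * Re (z1 * cnj \<omega>) / s z1"
  have l1: "2 * Re (z1 * cnj \<omega>) = l * s z1" using s[of z1] by (simp add: l_def)
  have "s z2 * Re (z1 * cnj \<omega>) = s z1 * Re (z2 * cnj \<omega>)"
    using orth by (simp add: v_def algebra_simps)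
  then have l2: "2 * Re (z2 * cnj \<omega>) = l * s z2"
    using s[of z1] by (simp add: l_def field_simps)
  have \<omega>\<omega>: "\<omega> * cnj \<omega> = 1" using complex_norm_square[of \<omega>] \<omega> by simp
  \<comment> \<open>If \<open>l\<^sup>2 \<ge> 1\<close>, the set meets the closed disk in at most the single point \<open>l \<omega>\<close>.\<close>
  have l: "l\<^sup>2 < 1"
  proof (rule ccontr)
    assume ge: "\<not> l\<^sup>2 < 1"
    have end_pt: "w = of_real l * \<omega>" if "2 * Re (w * cnj \<omega>) = l * s w" for w
    proof -
      let ?y = "w * cnj \<omega>"
      have ny: "cmod ?y = cmod w" by (simp add: norm_mult \<omega>)
      have "(cmod (?y - of_real l))\<^sup>2 = (cmod ?y)\<^sup>2 - l * (2 * Re ?y) + l\<^sup>2"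
        unfolding cmod_power2 by (simp add: power2_eq_square algebra_simps)
      also have "\<dots> = (cmod w)\<^sup>2 * (1 - l\<^sup>2)"
        unfolding that ny by (simp add: s_def power2_eq_square algebra_simps)
      also have "\<dots> \<le> 0" using ge by (simp add: mult_nonneg_nonpos)
      finally have "?y = of_real l" by simp
      then have "w * (cnj \<omega> * \<omega>) = of_real l * \<omega>" by (simp add: mult.assoc[symmetric])
      then show ?thesis using \<omega>\<omega> by (simp add: mult.commute)
    qed
    show False using end_pt[OF l1] end_pt[OF l2] ne by simp
  qed
  define r where "r = sqrt (1 - l\<^sup>2)"
  have r: "0 < r" "r\<^sup>2 = 1 - l\<^sup>2" using l by (simp_all add: r_def)
  \<comment> \<open>The root of \<open>l (1 + c\<^sup>2) = 2 c\<close> in \<open>(-1, 1)\<close>.\<close>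
  define c where "c = l / (1 + r)"
  have c2: "c\<^sup>2 = (1 - r) / (1 + r)"
  proof -
    have "l\<^sup>2 = (1 - r) * (1 + r)" using r by (simp add: power2_eq_square algebra_simps)
    then show ?thesis using r by (simp add: c_def power_divide power2_eq_square)
  qed
  have "c\<^sup>2 < 1" using r unfolding c2 by simp
  then have c: "\<bar>c\<bar> < 1" by (simp add: abs_square_less_1)
  have lc: "l * (1 + c\<^sup>2) = 2 * c" using r unfolding c2 by (simp add: c_def field_simps)
  have hit: "(1 + c\<^sup>2) * Re (w * cnj \<omega>) = c * ((cmod w)\<^sup>2 + 1)" if "2 * Re (w * cnj \<omega>) = l * s w" for w
  proof -
    have "2 * ((1 + c\<^sup>2) * Re (w * cnj \<omega>)) = (1 + c\<^sup>2) * (2 * Re (w * cnj \<omega>))" by (simp only: mult_ac)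
    also have "\<dots> = (l * (1 + c\<^sup>2)) * s w" unfolding that by (simp only: mult_ac)
    finally show ?thesis unfolding lc by (simp add: s_def)
  qed
  obtain x1 where x1: "\<bar>x1\<bar> \<le> 1" "geodesic c \<omega> x1 = z1"
    by (rule geodesic_hits[OF \<omega> c z(1) hit[OF l1]])
  obtain x2 where x2: "\<bar>x2\<bar> \<le> 1" "geodesic c \<omega> x2 = z2"
    by (rule geodesic_hits[OF \<omega> c z(2) hit[OF l2]])
  \<comment> \<open>The two orientations of the geodesic are exchanged by reversing the signs of \<open>c\<close>, \<open>\<omega>\<close> and \<open>x\<close>.\<close>
  show ?thesis
  proof (cases "x1 < x2")
    case True
    then show ?thesis using that[of c \<omega> x1 x2] c \<omega> x1 x2 by auto
  next
    case False
    moreover have "x1 \<noteq> x2" using x1 x2 ne by auto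
    ultimately show ?thesis
      using that[of "- c" "- \<omega>" "- x1" "- x2"] c \<omega> x1 x2 by (auto simp: geodesic_reverse)
  qed
qed

lemma bounded_bilinear_complex_scale:
  "bounded_bilinear ((*s) :: complex \<Rightarrow> complex ^ 'n \<Rightarrow> complex ^ 'n)"
proof (rule bilinear_conv_bounded_bilinear[THEN iffD1])
  show "bilinear ((*s) :: complex \<Rightarrow> complex ^ 'n \<Rightarrow> complex ^ 'n)"
    unfolding bilinear_def by (auto intro!: linearI simp: vec_eq_iff algebra_simps)
qed

lemmas has_vector_derivative_complex_scale =
  bounded_bilinear.has_vector_derivative[OF bounded_bilinear_complex_scale]

text \<open>The Schwarz-Pick identity \<open>\<bar>T'\<bar> (1 - x\<^sup>2) = 1 - \<bar>T\<bar>\<^sup>2\<close> and the monotonicity of \<open>(1 - x\<^sup>2)\<^sup>2 p x\<close> give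
  \<open>\<bar>T'\<bar>\<^sup>2 p \<bar>T\<bar> \<le> p x\<close>, so the criterion on the disk becomes a bound by \<open>2 p\<close> along every geodesic.
  All inequalities in the chain are equalities if the last one is. Subtracting \<open>w\<close> moves the
  later center of inversion to the origin.\<close>

lemma geodesic_image_curve:
  fixes \<phi> :: "complex \<Rightarrow> complex ^ 'n"
  assumes p: "nehari_function p"
    and hol: "curve_holomorphic_on \<phi> (ball 0 1)"
    and immersed: "\<forall>z\<in>ball 0 1. curve_deriv \<phi> z \<noteq> 0"
    and criterion: "\<forall>z\<in>ball 0 1. criterion_lhs \<phi> z \<le> 2 * p (cmod z)"
    and c: "\<bar>c\<bar> < 1" and \<omega>: "cmod \<omega> = 1"
  obtains q1 q2 q3 where
    "regular_curve {-1<..<1} (\<lambda>x. \<phi> (geodesic c \<omega> x) - w) q1 q2 q3"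
    "\<And>x. x \<in> {-1<..<1} \<Longrightarrow> ahlfors_schwarzian (q1 x) (q2 x) (q3 x) \<le> 2 * p x"
    "\<And>x. x \<in> {-1<..<1} \<Longrightarrow> ahlfors_schwarzian (q1 x) (q2 x) (q3 x) = 2 * p x \<Longrightarrow>
       criterion_lhs \<phi> (geodesic c \<omega> x) = 2 * p (cmod (geodesic c \<omega> x))"
proof -
  let ?I = "{-1<..<1::real}"
  define T where "T = geodesic c \<omega>"
  define t where "t = geodesic_velocity c \<omega>"
  define \<tau> where "\<tau> = geodesic_log_acceleration c"
  define d1 where "d1 = curve_deriv \<phi>"
  define d2 where "d2 = curve_deriv (curve_deriv \<phi>)"
  define d3 where "d3 = curve_deriv (curve_deriv (curve_deriv \<phi>))"
  define q1 where "q1 x = t x *s d1 (T x)" for x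
  define q2 where "q2 x = (t x)\<^sup>2 *s d2 (T x) + (t x * \<tau> x) *s d1 (T x)" for x
  define q3 where "q3 x = t x ^ 3 *s d3 (T x) + (3 * (t x)\<^sup>2 * \<tau> x) *s d2 (T x)
      + (3 / 2 * t x * (\<tau> x)\<^sup>2) *s d1 (T x)" for x
  have T: "(T has_vector_derivative t x) (at x)" "(t has_vector_derivative t x * \<tau> x) (at x)"
    "((\<lambda>x. t x * \<tau> x) has_vector_derivative 3 / 2 * t x * (\<tau> x)\<^sup>2) (at x)" for x
    unfolding T_def t_def \<tau>_def by (rule geodesic_has_derivatives)+
  have disc: "T x \<in> ball 0 1" if "x \<in> ?I" for x
    using geodesic_in_disc[OF \<omega> c, of x] that by (auto simp: T_def abs_less_iff)
  have hol1: "curve_holomorphic_on d1 (ball 0 1)" unfolding d1_def by (rule curve_holomorphic_deriv[OF hol open_ball])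
  have hol2: "curve_holomorphic_on d2 (ball 0 1)" unfolding d2_def d1_def[symmetric] by (rule curve_holomorphic_deriv[OF hol1 open_ball])
  have c2: "c\<^sup>2 < 1" using c by (simp add: abs_square_less_1)
  have t: "cmod (t x) = (1 - c\<^sup>2) / (1 + c\<^sup>2 * x\<^sup>2)" for x
    unfolding t_def by (rule norm_geodesic_velocity[OF \<omega> c])
  have t0: "t x \<noteq> 0" for x
  proof -
    have "0 < cmod (t x)" unfolding t using c2 by (intro divide_pos_pos add_pos_nonneg) auto
    then show ?thesis by simp
  qed
  have d1: "d1 (T x) \<noteq> 0" if "x \<in> ?I" for x using immersed disc[OF that] by (simp add: d1_def)
  have reg: "regular_curve ?I (\<lambda>x. \<phi> (T x) - w) q1 q2 q3"
    unfolding regular_curve_def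
  proof (intro ballI conjI)
    fix x assume x: "x \<in> ?I"
    show "q1 x \<noteq> 0" using t0[of x] d1[OF x] by (auto simp: q1_def vec_eq_iff)
    have D: "((\<lambda>x. \<phi> (T x)) has_vector_derivative t x *s d1 (T x)) (at x)"
      "((\<lambda>x. d1 (T x)) has_vector_derivative t x *s d2 (T x)) (at x)"
      "((\<lambda>x. d2 (T x)) has_vector_derivative t x *s d3 (T x)) (at x)"
      using curve_holomorphic_chain[OF hol open_ball disc[OF x] T(1)]
        curve_holomorphic_chain[OF hol1 open_ball disc[OF x] T(1)]
        curve_holomorphic_chain[OF hol2 open_ball disc[OF x] T(1)]
      by (simp_all only: d1_def d2_def d3_def)
    show "((\<lambda>x. \<phi> (T x) - w) has_vector_derivative q1 x) (at x)"
      using has_vector_derivative_diff[OF D(1) has_vector_derivative_const] by (simp add: q1_def)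
    have "(q1 has_vector_derivative t x *s (t x *s d2 (T x)) + (t x * \<tau> x) *s d1 (T x)) (at x)"
      unfolding q1_def by (rule has_vector_derivative_complex_scale[OF T(2) D(2)])
    then show "(q1 has_vector_derivative q2 x) (at x)"
      by (simp add: q2_def power2_eq_square vector_smult_assoc)
    have "((\<lambda>x. t x * t x) has_vector_derivative t x * (t x * \<tau> x) + (t x * \<tau> x) * t x) (at x)"
      by (rule has_vector_derivative_mult[OF T(2) T(2)])
    then have "((\<lambda>x. (t x)\<^sup>2) has_vector_derivative 2 * (t x)\<^sup>2 * \<tau> x) (at x)"
      by (simp add: power2_eq_square mult_ac)
    from has_vector_derivative_add[OF has_vector_derivative_complex_scale[OF this D(3)]
        has_vector_derivative_complex_scale[OF T(3) D(2)]]
    have "(q2 has_vector_derivative ((t x)\<^sup>2 *s (t x *s d3 (T x)) + (2 * (t x)\<^sup>2 * \<tau> x) *s d2 (T x))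
        + ((t x * \<tau> x) *s (t x *s d2 (T x)) + (3 / 2 * t x * (\<tau> x)\<^sup>2) *s d1 (T x))) (at x)"
      unfolding q2_def .
    moreover have "((t x)\<^sup>2 *s (t x *s d3 (T x)) + (2 * (t x)\<^sup>2 * \<tau> x) *s d2 (T x))
        + ((t x * \<tau> x) *s (t x *s d2 (T x)) + (3 / 2 * t x * (\<tau> x)\<^sup>2) *s d1 (T x)) = q3 x"
      by (simp add: q3_def vec_eq_iff power2_eq_square power3_eq_cube algebra_simps)
    ultimately show "(q2 has_vector_derivative q3 x) (at x)" by (simp only:)
  qed
  have chain: "ahlfors_schwarzian (q1 x) (q2 x) (q3 x) \<le> (cmod (t x))\<^sup>2 * criterion_lhs \<phi> (T x)"
    if x: "x \<in> ?I" for x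
  proof -
    let ?S = "curve_schwarzian (d1 (T x)) (d2 (T x)) (d3 (T x))" and ?D = "curve_bending (d1 (T x)) (d2 (T x))"
    have "ahlfors_schwarzian (q1 x) (q2 x) (q3 x) = Re ((t x)\<^sup>2 * ?S) + (cmod (t x))\<^sup>2 * ?D"
      unfolding q1_def q2_def q3_def by (rule ahlfors_schwarzian_moebius_parameter[OF d1[OF x] t0])
    also have "\<dots> \<le> cmod ((t x)\<^sup>2 * ?S) + (cmod (t x))\<^sup>2 * \<bar>?D\<bar>"
      by (intro add_mono complex_Re_le_cmod mult_left_mono) auto
    also have "\<dots> = (cmod (t x))\<^sup>2 * criterion_lhs \<phi> (T x)"
      using criterion_lhs_eq[OF hol open_ball _ disc[OF x]] immersed
      by (simp add: d1_def d2_def d3_def norm_mult norm_power distrib_left)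
    finally show ?thesis .
  qed
  have nehari: "(cmod (t x))\<^sup>2 * p (cmod (T x)) \<le> p x" if x: "x \<in> ?I" for x
  proof -
    have x1: "\<bar>x\<bar> < 1" using x by auto
    have "\<bar>x\<bar> \<le> cmod (T x)" "cmod (T x) < 1"
      using geodesic_farther[OF \<omega> x1] disc[OF x] by (auto simp: T_def)
    moreover have mono: "antimono_on {0..<1} (\<lambda>x. (1 - x\<^sup>2)\<^sup>2 * p x)"
      using p by (simp add: nehari_function_def)
    ultimately have "(1 - (cmod (T x))\<^sup>2)\<^sup>2 * p (cmod (T x)) \<le> (1 - \<bar>x\<bar>\<^sup>2)\<^sup>2 * p \<bar>x\<bar>"
      using x1 by (intro monotone_onD[OF mono]) auto
    moreover have "p \<bar>x\<bar> = p x"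
      using p x by (auto simp: nehari_function_def abs_if)
    moreover have "1 - (cmod (T x))\<^sup>2 = cmod (t x) * (1 - x\<^sup>2)"
      unfolding t T_def one_minus_norm_geodesic[OF \<omega>] by simp
    ultimately have "(1 - x\<^sup>2)\<^sup>2 * ((cmod (t x))\<^sup>2 * p (cmod (T x))) \<le> (1 - x\<^sup>2)\<^sup>2 * p x"
      by (simp add: power_mult_distrib mult_ac)
    moreover have "0 < (1 - x\<^sup>2)\<^sup>2" using x1 abs_square_less_1[of x] by simp
    ultimately show ?thesis by (simp only: mult_le_cancel_left_pos)
  qed
  have bound: "(cmod (t x))\<^sup>2 * criterion_lhs \<phi> (T x) \<le> (cmod (t x))\<^sup>2 * (2 * p (cmod (T x)))" if "x \<in> ?I" for x
    using criterion disc[OF that] by (intro mult_left_mono) auto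
  show ?thesis
  proof (rule that[of q1 q2 q3])
    show "regular_curve ?I (\<lambda>x. \<phi> (geodesic c \<omega> x) - w) q1 q2 q3" using reg by (simp add: T_def)
    show "ahlfors_schwarzian (q1 x) (q2 x) (q3 x) \<le> 2 * p x" if "x \<in> ?I" for x
      using chain[OF that] bound[OF that] nehari[OF that] by linarith
    show "criterion_lhs \<phi> (geodesic c \<omega> x) = 2 * p (cmod (geodesic c \<omega> x))"
      if x: "x \<in> ?I" and eq: "ahlfors_schwarzian (q1 x) (q2 x) (q3 x) = 2 * p x" for x
    proof -
      have "(cmod (t x))\<^sup>2 * criterion_lhs \<phi> (T x) = (cmod (t x))\<^sup>2 * (2 * p (cmod (T x)))"
        using chain[OF x] bound[OF x] nehari[OF x] eq by linarith
      then show ?thesis using t0[of x] by (simp add: T_def)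
    qed
  qed
qed

lemma continuous_geodesic: "continuous (at x within A) (geodesic c \<omega>)"
  using has_vector_derivative_continuous[OF geodesic_has_derivatives(1)] continuous_at_imp_continuous_at_within by blast

section \<open>Spherical boundary limits\<close>

lemma extension_tendsto:
  fixes \<phi> :: "complex \<Rightarrow> complex ^ 'n"
  assumes ext: "spherical_extension \<phi> \<Phi>" and \<zeta>: "\<zeta> \<in> cball 0 1"
    and T: "(T \<longlongrightarrow> \<zeta>) F" "eventually (\<lambda>x. T x \<in> ball 0 1) F"
  shows "((\<lambda>x. stereo (Some (\<phi> (T x)))) \<longlongrightarrow> stereo (\<Phi> \<zeta>)) F"
proof -
  have "continuous_on (cball 0 1) (stereo \<circ> \<Phi>)"
    using ext by (simp add: spherical_extension_def)
  then have "((\<lambda>x. (stereo \<circ> \<Phi>) (T x)) \<longlongrightarrow> (stereo \<circ> \<Phi>) \<zeta>) F"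
    by (rule continuous_on_tendsto_compose[OF _ T(1) \<zeta>]) (use T(2) in \<open>auto elim: eventually_mono\<close>)
  then have "((\<lambda>x. (stereo \<circ> \<Phi>) (T x)) \<longlongrightarrow> stereo (\<Phi> \<zeta>)) F" by simp
  moreover have "eventually (\<lambda>x. (stereo \<circ> \<Phi>) (T x) = stereo (Some (\<phi> (T x)))) F"
    using T(2) ext by (auto simp: spherical_extension_def elim: eventually_mono)
  ultimately show ?thesis by (rule Lim_transform_eventually)
qed

text \<open>A finite point is recovered from its stereographic image by a formula that is continuous away from the
  pole.\<close>

lemma stereo_Some_tendsto_finite:
  fixes f :: "'b \<Rightarrow> complex ^ 'n"
  assumes "((\<lambda>x. stereo (Some (f x))) \<longlongrightarrow> stereo (Some w)) F"
  shows "(f \<longlongrightarrow> w) F"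
proof -
  have pos: "0 < (norm v)\<^sup>2 + 1" for v :: "complex ^ 'n" by (simp add: add_nonneg_pos)
  have snd: "1 - snd (stereo (Some v)) = 2 / ((norm v)\<^sup>2 + 1)" for v :: "complex ^ 'n"
    using pos[of v] by (simp add: stereo_def field_simps)
  have inverse: "(1 / (1 - snd (stereo (Some v)))) *\<^sub>R fst (stereo (Some v)) = v" for v :: "complex ^ 'n"
  proof -
    have "1 / (2 / m) * (2 / m) = 1" if "0 < m" for m :: real using that by simp
    from this[OF pos[of v]] show ?thesis unfolding snd by (simp only: stereo_def option.case fst_conv scaleR_scaleR scaleR_one)
  qed
  have "((\<lambda>x. (1 / (1 - snd (stereo (Some (f x))))) *\<^sub>R fst (stereo (Some (f x)))) \<longlongrightarrow>
      (1 / (1 - snd (stereo (Some w)))) *\<^sub>R fst (stereo (Some w))) F"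
    by (intro tendsto_intros assms) (use pos[of w] in \<open>simp add: snd\<close>)
  then show ?thesis unfolding inverse .
qed

lemma stereo_Some_tendsto_infinity:
  fixes f :: "'b \<Rightarrow> complex ^ 'n"
  assumes "((\<lambda>x. stereo (Some (f x))) \<longlongrightarrow> stereo None) F"
  shows "filterlim (\<lambda>x. norm (f x)) at_top F"
proof -
  have pos: "0 < (norm v)\<^sup>2 + 1" for v :: "complex ^ 'n" by (simp add: add_nonneg_pos)
  have snd: "1 - snd (stereo (Some v)) = 2 / ((norm v)\<^sup>2 + 1)" for v :: "complex ^ 'n"
    using pos[of v] by (simp add: stereo_def field_simps)
  have "((\<lambda>x. 1 - snd (stereo (Some (f x)))) \<longlongrightarrow> 1 - snd (stereo (None :: (complex ^ 'n) option))) F"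
    by (intro tendsto_intros assms)
  then have "((\<lambda>x. 1 - snd (stereo (Some (f x)))) \<longlongrightarrow> 0) F" by (simp add: stereo_def)
  then have "filterlim (\<lambda>x. inverse (1 - snd (stereo (Some (f x))))) at_top F"
    by (rule filterlim_inverse_at_top) (use pos in \<open>simp add: snd\<close>)
  then have half: "filterlim (\<lambda>x. ((norm (f x))\<^sup>2 + 1) / 2) at_top F"
    by (simp add: snd)
  have le: "((norm v)\<^sup>2 + 1) / 2 \<le> (norm v + 1)\<^sup>2" for v :: "complex ^ 'n"
  proof -
    have "(s + 1) / 2 \<le> s + 1 + 2 * t" if "0 \<le> s" "0 \<le> t" for s t :: real
      using that by (simp add: field_simps)
    from this[of "(norm v)\<^sup>2" "norm v"] show ?thesis by (simp add: power2_sum)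
  qed
  have "filterlim (\<lambda>x. (norm (f x) + 1)\<^sup>2) at_top F"
    by (rule filterlim_at_top_mono[OF half]) (intro always_eventually allI le)
  then have "filterlim (\<lambda>x. sqrt ((norm (f x) + 1)\<^sup>2)) at_top F"
    by (rule filterlim_compose[OF sqrt_at_top])
  then have "filterlim (\<lambda>x. norm (f x) + 1) at_top F" by simp
  from filterlim_tendsto_add_at_top[OF tendsto_const[of "-1"] this] show ?thesis by simp
qed

section \<open>Injectivity\<close>

lemma last_zero_before:
  fixes q :: "real \<Rightarrow> 'a::real_normed_vector"
  assumes "continuous_on {a..b} q" "a \<le> b" "q a = 0" "q b \<noteq> 0"
  obtains s where "a \<le> s" "s < b" "q s = 0" "\<And>x. s < x \<Longrightarrow> x \<le> b \<Longrightarrow> q x \<noteq> 0"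
proof -
  let ?Z = "{x \<in> {a..b}. q x = 0}"
  have "closed ?Z" by (rule continuous_closed_preimage_constant[OF assms(1)]) simp
  then have "compact ({a..b} \<inter> ?Z)" by (rule compact_Int_closed[OF compact_Icc])
  moreover have "{a..b} \<inter> ?Z = ?Z" by blast
  ultimately have "compact ?Z" by (simp only:)
  moreover have "?Z \<noteq> {}" using assms(2,3) by auto
  ultimately obtain s where s: "s \<in> ?Z" "\<And>t. t \<in> ?Z \<Longrightarrow> t \<le> s"
    using compact_attains_sup[of ?Z] by blast
  show ?thesis
  proof (rule that[of s])
    show "q x \<noteq> 0" if "s < x" "x \<le> b" for x using s(1) s(2)[of x] that by auto
  qed (use s assms(4) in \<open>auto simp: order.order_iff_strict\<close>)
qed

lemma first_zero_after:
  fixes q :: "real \<Rightarrow> 'a::real_normed_vector"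
  assumes "continuous_on {a..b} q" "a \<le> b" "q a \<noteq> 0" "q b = 0"
  obtains s where "a < s" "s \<le> b" "q s = 0" "\<And>x. a \<le> x \<Longrightarrow> x < s \<Longrightarrow> q x \<noteq> 0"
proof -
  have "continuous_on {- b..- a} (\<lambda>x. q (- x))"
    by (rule continuous_on_compose2[OF assms(1)]) (auto intro!: continuous_intros)
  then obtain s where s: "- b \<le> s" "s < - a" "q (- s) = 0" "\<And>x. s < x \<Longrightarrow> x \<le> - a \<Longrightarrow> q (- x) \<noteq> 0"
    by (rule last_zero_before) (use assms(2-4) in auto)
  show ?thesis
  proof (rule that[of "- s"])
    show "q x \<noteq> 0" if "a \<le> x" "x < - s" for x using s(4)[of "- x"] that by simp
  qed (use s in auto)
qed

text \<open>Two points with the same value lie on a geodesic along which \<open>q = \<phi> - w\<close> starts with a zero. The zero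
  is simple, so \<open>q\<close> is nonzero somewhere before the second point, and this produces an arc of the
  kind that cannot exist. In particular \<open>\<phi>\<close> is injective, and a boundary value is never
  attained inside the disk.\<close>

lemma extension_injective_from_interior:
  fixes \<phi> :: "complex \<Rightarrow> complex ^ 'n"
  assumes p: "nehari_function p"
    and hol: "curve_holomorphic_on \<phi> (ball 0 1)"
    and immersed: "\<forall>z\<in>ball 0 1. curve_deriv \<phi> z \<noteq> 0"
    and criterion: "\<forall>z\<in>ball 0 1. criterion_lhs \<phi> z \<le> 2 * p (cmod z)"
    and ext: "spherical_extension \<phi> \<Phi>"
    and z: "z1 \<in> ball 0 1" "z2 \<in> cball 0 1" "\<Phi> z1 = \<Phi> z2"
  shows "z1 = z2"
proof (rule ccontr)
  assume ne: "z1 \<noteq> z2"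
  obtain c \<omega> x1 x2 where g: "\<bar>c\<bar> < 1" "cmod \<omega> = 1" "-1 \<le> x1" "x1 < x2" "x2 \<le> 1"
    "geodesic c \<omega> x1 = z1" "geodesic c \<omega> x2 = z2"
    by (rule geodesic_through[of z1 z2]) (use ne z in auto)
  obtain u u' where u: "positive_solution p u u'"
    using nehari_positive_solution[OF p] by blast
  define w where "w = \<phi> z1"
  have \<Phi>: "\<Phi> z = Some (\<phi> z)" if "z \<in> ball 0 1" for z
    using ext that by (simp add: spherical_extension_def)
  define q where "q x = \<phi> (geodesic c \<omega> x) - w" for x
  obtain q1 q2 q3 where C: "regular_curve {-1<..<1} q q1 q2 q3"
    and S: "\<And>x. x \<in> {-1<..<1} \<Longrightarrow> ahlfors_schwarzian (q1 x) (q2 x) (q3 x) \<le> 2 * p x"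
    using geodesic_image_curve[OF p hol immersed criterion g(1,2), of w] unfolding q_def[abs_def] by metis
  have disc: "geodesic c \<omega> x \<in> ball 0 1" if "x \<in> {-1<..<1}" for x
    using geodesic_in_disc[OF g(2,1), of x] that by (auto simp: abs_less_iff)
  have cont: "continuous_on {s..t} q" if "-1 < s" "t < 1" for s t
    by (rule continuous_on_subset[OF regular_curve_continuous(1)[OF C]]) (use that in auto)
  have qx1: "q x1 = 0" using g(6) by (simp add: q_def w_def)
  have "x1 \<noteq> -1"
  proof
    assume "x1 = -1"
    then have "1 - (cmod z1)\<^sup>2 = 0" using one_minus_norm_geodesic[OF g(2), of c x1] g(6) by simp
    then have "(cmod z1)\<^sup>2 = 1\<^sup>2" by simp
    then have "cmod z1 = 1" by (rule power2_eq_imp_eq) simp_all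
    then show False using z(1) by simp
  qed
  then have x1: "-1 < x1" using g(3) by simp
  have "\<exists>y. x1 < y \<and> y < x2 \<and> q y \<noteq> 0"
  proof (rule ccontr)
    assume none: "\<not> ?thesis"
    define m where "m = (x1 + x2) / 2"
    have m: "m \<in> {x1<..<x2}" "m \<in> {-1<..<1}" using x1 g by (auto simp: m_def)
    have "(q has_vector_derivative q1 m) (at m)" "q1 m \<noteq> 0" using C m by (auto simp: regular_curve_def)
    moreover have "(q has_vector_derivative 0) (at m)"
      by (rule has_vector_derivative_transform_within_open[OF has_vector_derivative_const[of 0] _ m(1)])
         (use none in auto)
    ultimately show False using vector_derivative_unique_at by blast
  qed
  then obtain y where y: "x1 < y" "y < x2" "q y \<noteq> 0" by blast
  \<comment> \<open>The component of \<open>{x. q x \<noteq> 0}\<close> that contains \<open>y\<close> starts at a zero \<open>a\<close> and ends at a zero or at \<open>1\<close>.\<close>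
  obtain a where a: "x1 \<le> a" "a < y" "q a = 0" "\<And>x. a < x \<Longrightarrow> x \<le> y \<Longrightarrow> q x \<noteq> 0"
    by (rule last_zero_before[of x1 y q]) (use cont[of x1 y] x1 y g qx1 in auto)
  show False
  proof (cases "\<exists>t. y \<le> t \<and> t < 1 \<and> q t = 0")
    case True
    then obtain t where t: "y \<le> t" "t < 1" "q t = 0" by blast
    obtain b where b: "y < b" "b \<le> t" "q b = 0" "\<And>x. y \<le> x \<Longrightarrow> x < b \<Longrightarrow> q x \<noteq> 0"
      by (rule first_zero_after[of y t q]) (use cont[of y t] x1 y t in auto)
    have "isCont q b"
      using regular_curve_continuous(1)[OF C] x1 y b t by (simp add: continuous_on_eq_continuous_at)
    then have qb: "(q \<longlongrightarrow> 0) (at_left b)"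
      using b(3) by (auto simp: isCont_def intro: filterlim_mono[OF _ order_refl at_le])
    show False
    proof (rule no_arc_between_zeros[OF u C S])
      show "-1 < a" "a < b" "b \<le> 1" using a(1,2) b(1,2) x1 t(2) by linarith+
      show "q x \<noteq> 0" if "x \<in> {a<..<b}" for x
        using a(4)[of x] b(4)[of x] that by (cases "x \<le> y") auto
    qed (use a(3) qb in simp_all)
  next
    case False
    have x2: "x2 = 1"
    proof (rule ccontr)
      assume "x2 \<noteq> 1"
      then have x2: "x2 \<in> {-1<..<1}" using g(5) x1 g(4) by auto
      have "\<Phi> z2 = Some (\<phi> z2)" using \<Phi> disc[OF x2] g(7) by simp
      then have "q x2 = 0" using z(3) \<Phi>[OF z(1)] g(7) by (simp add: q_def w_def)
      then show False using False y(2) x2 by auto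
    qed
    have "(geodesic c \<omega> \<longlongrightarrow> z2) (at_left 1)"
      using continuous_geodesic[of 1 "{..<1}" c \<omega>] g(7) x2 by (simp add: continuous_within)
    moreover have "eventually (\<lambda>x. geodesic c \<omega> x \<in> ball 0 1) (at_left 1)"
      by (rule eventually_at_leftI[of "-1"], rule disc) auto
    ultimately have "((\<lambda>x. stereo (Some (\<phi> (geodesic c \<omega> x)))) \<longlongrightarrow> stereo (\<Phi> z2)) (at_left 1)"
      by (rule extension_tendsto[OF ext z(2)])
    then have "((\<lambda>x. \<phi> (geodesic c \<omega> x)) \<longlongrightarrow> w) (at_left 1)"
      using z(3) \<Phi>[OF z(1)] by (intro stereo_Some_tendsto_finite) (simp add: w_def)
    then have q1lim: "(q \<longlongrightarrow> 0) (at_left 1)"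
      unfolding q_def by (rule LIM_zero)
    have nz: "q x \<noteq> 0" if "x \<in> {a<..<1}" for x
      using a(4)[of x] False that by (cases "x \<le> y") auto
    show False
    proof (rule no_arc_between_zeros[OF u C S, of a 1])
      show "-1 < a" "a < 1" using a(1,2) y(2) g(5) x1 by linarith+
    qed (use a(3) q1lim nz in simp_all)
  qed
qed

section \<open>The circle or line through a cut point\<close>

lemma euclidean_line_range:
  fixes A B :: "'a::euclidean_space"
  assumes "B \<noteq> 0"
  shows "euclidean_line (range (\<lambda>t. A + t *\<^sub>R B))"
proof -
  have eq: "range (\<lambda>t. A + t *\<^sub>R B) = (\<lambda>x. A + x) ` span {B}"
    by (auto simp: span_singleton)
  have "independent {B}" using assms by simp
  then have "dim (span {B}) = 1" by (simp add: dim_eq_card_independent)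
  then show ?thesis
    unfolding euclidean_line_def eq
    by (simp add: affine_translation[symmetric] aff_dim_translation_eq aff_dim_subspace subspace_imp_affine del: dim_span)
qed

text \<open>With \<open>a\<close> the nearest point to the origin on the line, \<open>C\<close> is the circle through \<open>w\<close> and \<open>w + a / \<bar>a\<bar>\<^sup>2\<close>
  that has these points as a diameter. For \<open>y = w + v\<close> in its plane, lying on it means \<open>\<bar>v\<bar>\<^sup>2 = inner v a / \<bar>a\<bar>\<^sup>2\<close>,
  which says exactly that the inversion of \<open>v\<close> lies on the line.\<close>

lemma inverted_line_circle:
  fixes A B w :: "'a::euclidean_space"
  assumes B: "B \<noteq> 0" and avoid: "\<And>t. A + t *\<^sub>R B \<noteq> 0"
  obtains C where "euclidean_circle C" "C - {w} \<subseteq> range (\<lambda>t. w + inversion (A + t *\<^sub>R B))"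
proof -
  \<comment> \<open>\<open>a\<close> is the point of the line nearest to the origin.\<close>
  define s where "s = inner A B / inner B B"
  define a where "a = A - s *\<^sub>R B"
  have a0: "a \<noteq> 0" using avoid[of "- s"] by (simp add: a_def)
  have orth: "inner a B = 0" using B by (simp add: a_def s_def inner_diff_left)
  have "a \<noteq> B" using orth B by auto
  have ind: "independent {a, B}"
    by (rule pairwise_orthogonal_independent) (use a0 B orth in \<open>auto simp: pairwise_def orthogonal_def inner_commute\<close>)
  then have dim: "dim (span {a, B}) = 2"
    using \<open>a \<noteq> B\<close> by (simp add: dim_eq_card_independent)
  define P where "P = (\<lambda>x. w + x) ` span {a, B}"
  define m where "m = w + (1 / (2 * inner a a)) *\<^sub>R a"
  define r where "r = 1 / (2 * norm a)"
  have circle: "euclidean_circle (P \<inter> sphere m r)"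
    unfolding euclidean_circle_def
  proof (intro exI conjI)
    show "affine P" "aff_dim P = 2"
      using dim by (simp_all add: P_def affine_translation[symmetric] aff_dim_translation_eq aff_dim_subspace subspace_imp_affine del: dim_span)
    have "(1 / (2 * inner a a)) *\<^sub>R a \<in> span {a, B}" by (rule span_scale, rule span_base) simp
    then show "m \<in> P" unfolding P_def m_def by (rule imageI)
    show "0 < r" using a0 by (simp add: r_def)
  qed (rule refl)
  have "y \<in> range (\<lambda>t. w + inversion (A + t *\<^sub>R B))" if y: "y \<in> P" "y \<in> sphere m r" "y \<noteq> w" for y
  proof -
    obtain v where v: "v \<in> span {a, B}" "y = w + v" using y(1) by (auto simp: P_def)
    obtain \<alpha> \<beta> where v': "v = \<alpha> *\<^sub>R a + \<beta> *\<^sub>R B"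
      using v(1) by (auto simp: span_insert span_singleton algebra_simps)
    have v0: "v \<noteq> 0" using y(3) v(2) by simp
    have N: "inner a a \<noteq> 0" using a0 by simp
    have va: "inner v a = \<alpha> * inner a a" using orth inner_commute[of B a] by (simp add: v' inner_add_left)
    have "dist m y = r" using y(2) by simp
    then have "(norm (v - (1 / (2 * inner a a)) *\<^sub>R a))\<^sup>2 = r\<^sup>2"
      by (simp add: dist_norm norm_minus_commute m_def v(2))
    moreover have "(norm (v - (1 / (2 * inner a a)) *\<^sub>R a))\<^sup>2 = inner v v - \<alpha> + r\<^sup>2"
    proof -
      have r2: "r\<^sup>2 = 1 / (4 * inner a a)" by (simp add: r_def power_divide power_mult_distrib dot_square_norm)
      show ?thesis
        unfolding power2_norm_eq_inner r2 using N
        by (simp add: inner_diff_left inner_diff_right va inner_commute[of a v] field_simps)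
    qed
    ultimately have vv: "inner v v = \<alpha>" by simp
    then have \<alpha>: "\<alpha> \<noteq> 0" using v0 by auto
    have "inversion v = a + (\<beta> / \<alpha>) *\<^sub>R B"
      unfolding inversion_def vv using \<alpha> by (simp add: v' scaleR_add_right)
    also have "\<dots> = A + (\<beta> / \<alpha> - s) *\<^sub>R B" by (simp add: a_def algebra_simps)
    finally have "inversion (inversion v) = inversion (A + (\<beta> / \<alpha> - s) *\<^sub>R B)" by (rule arg_cong)
    then have "y = w + inversion (A + (\<beta> / \<alpha> - s) *\<^sub>R B)" by (simp add: inversion_inversion v(2))
    then show ?thesis by blast
  qed
  then show ?thesis by (intro that[OF circle]) blast
qed

theorem theorem3:
  fixes p :: "real \<Rightarrow> real"
    and \<phi> :: "complex \<Rightarrow> complex ^ 'n"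
    and \<Phi> :: "complex \<Rightarrow> (complex ^ 'n) option"
    and P :: "(complex ^ 'n) option"
  assumes nehari: "nehari_function p"
    and hol: "curve_holomorphic_on \<phi> (ball 0 1)"
    and immersed: "\<forall>z\<in>ball 0 1. curve_deriv \<phi> z \<noteq> 0"
    and criterion: "\<forall>z\<in>ball 0 1. criterion_lhs \<phi> z \<le> 2 * p (cmod z)"
    and extension: "spherical_extension \<phi> \<Phi>"
    and not_simple: "\<not> inj_on \<Phi> (sphere 0 1)"
    and cut: "cut_point \<Phi> P"
  shows "\<exists>C. (euclidean_circle C \<or> euclidean_line C)
           \<and> Some ` C - {P} \<subseteq> Some ` \<phi> ` ball 0 1
           \<and> (\<forall>z\<in>ball 0 1. Some (\<phi> z) \<in> Some ` C - {P} \<longrightarrow> criterion_lhs \<phi> z = 2 * p (cmod z))"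
proof -
  let ?I = "{-1<..<1::real}"
  obtain u u' where u: "positive_solution p u u'"
    using nehari_positive_solution[OF nehari] by blast
  have \<Phi>: "\<Phi> z = Some (\<phi> z)" if "z \<in> ball 0 1" for z
    using extension that by (simp add: spherical_extension_def)
  have inj: "z = z'" if "z \<in> ball 0 1" "z' \<in> cball 0 1" "\<Phi> z = \<Phi> z'" for z z'
    by (rule extension_injective_from_interior[OF nehari hol immersed criterion extension that])
  obtain \<zeta>1 \<zeta>2 where \<zeta>: "cmod \<zeta>1 = 1" "cmod \<zeta>2 = 1" "\<zeta>1 \<noteq> \<zeta>2" "\<Phi> \<zeta>1 = P" "\<Phi> \<zeta>2 = P"
    using cut by (auto simp: cut_point_def)
  obtain c \<omega> x1 x2 where g: "\<bar>c\<bar> < 1" "cmod \<omega> = 1" "-1 \<le> x1" "x1 < x2" "x2 \<le> 1"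
    "geodesic c \<omega> x1 = \<zeta>1" "geodesic c \<omega> x2 = \<zeta>2"
    by (rule geodesic_through[of \<zeta>1 \<zeta>2]) (use \<zeta> in auto)
  define T where "T = geodesic c \<omega>"
  have disc: "T x \<in> ball 0 1" if "x \<in> ?I" for x
    using geodesic_in_disc[OF g(2,1), of x] that by (auto simp: T_def abs_less_iff)
  have "x1 \<notin> ?I" "x2 \<notin> ?I" using disc[of x1] disc[of x2] g(6,7) \<zeta>(1,2) by (auto simp: T_def)
  then have ends: "x1 = -1" "x2 = 1" using g(3-5) by auto
  have "(T \<longlongrightarrow> \<zeta>2) (at_left 1)" "(T \<longlongrightarrow> \<zeta>1) (at_right (-1))"
    using continuous_geodesic[of 1 "{..<1}" c \<omega>] continuous_geodesic[of "-1" "{-1<..}" c \<omega>] g(6,7) ends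
    by (simp_all add: continuous_within T_def)
  moreover have "eventually (\<lambda>x. T x \<in> ball 0 1) (at_left 1)"
    by (rule eventually_at_leftI[of "-1"], rule disc) auto
  moreover have "eventually (\<lambda>x. T x \<in> ball 0 1) (at_right (-1))"
    by (rule eventually_at_rightI[of _ 1], rule disc) auto
  ultimately have lim: "((\<lambda>x. stereo (Some (\<phi> (T x)))) \<longlongrightarrow> stereo P) (at_left 1)"
    "((\<lambda>x. stereo (Some (\<phi> (T x)))) \<longlongrightarrow> stereo P) (at_right (-1))"
    using extension_tendsto[OF extension, of \<zeta>2 T "at_left 1"] extension_tendsto[OF extension, of \<zeta>1 T "at_right (-1)"] \<zeta>
    by auto
  have conclude: ?thesis
    if C: "euclidean_circle C \<or> euclidean_line C"
      and sub: "\<And>y. y \<in> C \<Longrightarrow> Some y \<noteq> P \<Longrightarrow> \<exists>x\<in>?I. y = \<phi> (T x)"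
      and eq: "\<And>x. x \<in> ?I \<Longrightarrow> criterion_lhs \<phi> (T x) = 2 * p (cmod (T x))" for C
  proof (intro exI[of _ C] conjI C ballI impI subsetI)
    fix y assume "y \<in> Some ` C - {P}"
    then obtain v where v: "y = Some v" "v \<in> C" "Some v \<noteq> P" by blast
    then obtain x where "x \<in> ?I" "v = \<phi> (T x)" using sub by blast
    then show "y \<in> Some ` \<phi> ` ball 0 1" using v(1) disc by blast
  next
    fix z assume z: "z \<in> ball 0 1" "Some (\<phi> z) \<in> Some ` C - {P}"
    then obtain x where x: "x \<in> ?I" "\<phi> z = \<phi> (T x)" using sub by blast
    have "z = T x"
      using inj[OF z(1), of "T x"] disc[OF x(1)] x(2) \<Phi>[OF z(1)] \<Phi>[OF disc[OF x(1)]] by auto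
    then show "criterion_lhs \<phi> z = 2 * p (cmod z)" using eq[OF x(1)] by simp
  qed
  show ?thesis
  proof (cases P)
    case None
    obtain q1 q2 q3 where C: "regular_curve ?I (\<lambda>x. \<phi> (T x) - 0) q1 q2 q3"
      and S: "\<And>x. x \<in> ?I \<Longrightarrow> ahlfors_schwarzian (q1 x) (q2 x) (q3 x) \<le> 2 * p x"
      and E: "\<And>x. x \<in> ?I \<Longrightarrow> ahlfors_schwarzian (q1 x) (q2 x) (q3 x) = 2 * p x \<Longrightarrow>
        criterion_lhs \<phi> (T x) = 2 * p (cmod (T x))"
      by (rule geodesic_image_curve[OF nehari hol immersed criterion g(1,2), of 0, folded T_def]) (rule that; blast)
    have C': "regular_curve ?I (\<lambda>x. \<phi> (T x)) q1 q2 q3" using C by simp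
    obtain A B where AB: "B \<noteq> 0" "(\<lambda>x. \<phi> (T x)) ` ?I = range (\<lambda>t. A + t *\<^sub>R B)"
      "\<And>x. x \<in> ?I \<Longrightarrow> ahlfors_schwarzian (q1 x) (q2 x) (q3 x) = 2 * p x"
      by (rule curve_rigidity[OF u C' S stereo_Some_tendsto_infinity stereo_Some_tendsto_infinity])
         (use lim None in auto)
    show ?thesis
    proof (rule conclude[of "range (\<lambda>t. A + t *\<^sub>R B)"])
      show "\<exists>x\<in>?I. y = \<phi> (T x)" if "y \<in> range (\<lambda>t. A + t *\<^sub>R B)" for y
        using that unfolding AB(2)[symmetric] by blast
    qed (use euclidean_line_range[OF AB(1)] E AB(3) in blast)+
  next
    case (Some w)
    let ?q = "\<lambda>x. \<phi> (T x) - w"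
    obtain q1 q2 q3 where C: "regular_curve ?I ?q q1 q2 q3"
      and S: "\<And>x. x \<in> ?I \<Longrightarrow> ahlfors_schwarzian (q1 x) (q2 x) (q3 x) \<le> 2 * p x"
      and E: "\<And>x. x \<in> ?I \<Longrightarrow> ahlfors_schwarzian (q1 x) (q2 x) (q3 x) = 2 * p x \<Longrightarrow>
        criterion_lhs \<phi> (T x) = 2 * p (cmod (T x))"
      by (rule geodesic_image_curve[OF nehari hol immersed criterion g(1,2), of w, folded T_def]) (rule that; blast)
    have nz: "?q x \<noteq> 0" if x: "x \<in> ?I" for x
    proof
      assume "?q x = 0"
      then have "T x = \<zeta>1"
        using \<Phi>[OF disc[OF x]] \<zeta> Some by (intro inj disc x) auto
      then show False using disc[OF x] \<zeta>(1) by simp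
    qed
    have lim0: "(?q \<longlongrightarrow> 0) (at_left 1)" "(?q \<longlongrightarrow> 0) (at_right (-1))"
      using lim unfolding Some by (auto intro: LIM_zero stereo_Some_tendsto_finite)
    obtain A B where AB: "B \<noteq> 0" "(\<lambda>x. inversion (?q x)) ` ?I = range (\<lambda>t. A + t *\<^sub>R B)"
      "\<And>x. x \<in> ?I \<Longrightarrow> ahlfors_schwarzian (q1 x) (q2 x) (q3 x) = 2 * p x"
      by (rule inverted_curve_rigidity[OF u C S nz lim0]) (assumption, assumption, (rule that; blast))
    have on_line: "\<exists>x\<in>?I. A + t *\<^sub>R B = inversion (?q x)" for t
      using AB(2) by (metis (no_types, lifting) imageE rangeI)
    have "A + t *\<^sub>R B \<noteq> 0" for t
    proof
      assume zero: "A + t *\<^sub>R B = 0"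
      obtain x where x: "x \<in> ?I" "A + t *\<^sub>R B = inversion (?q x)" using on_line by blast
      then have "norm (inversion (?q x)) = 0" using zero by simp
      then show False using nz[OF x(1)] by (simp add: norm_inversion)
    qed
    then obtain C where C: "euclidean_circle C" "C - {w} \<subseteq> range (\<lambda>t. w + inversion (A + t *\<^sub>R B))"
      using inverted_line_circle[OF AB(1), of A w] by blast
    show ?thesis
    proof (rule conclude[of C])
      fix y assume "y \<in> C" "Some y \<noteq> P"
      then obtain t where t: "y = w + inversion (A + t *\<^sub>R B)" using C(2) Some by blast
      obtain x where "x \<in> ?I" "A + t *\<^sub>R B = inversion (?q x)" using on_line by blast
      then show "\<exists>x\<in>?I. y = \<phi> (T x)" using t by (intro bexI[of _ x]) (simp_all add: inversion_inversion)
    qed (use C(1) E AB(3) in blast)+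
  qed
qed

end
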